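(* Let $(X_n)_{n\ge 1}$ be i.i.d. real valued random variables on a probability space $(\Omega,\mathcal A,\mathbb P)$ such that $\Lambda(\lambda)=\log \mathbb E(\exp(\lambda X_1))$ is finite over an interval $\mathcal D_\Lambda$ whose interior $\mathring{\mathcal D}_\Lambda$ contains $0$. Let $(k(n))_{n\ge 1}$ be a sequence of positive integers. Let $\lambda_0\in\mathring{\mathcal D}_\Lambda$ and denote $x_0=\Lambda'(\lambda_0)$. (1) If $\liminf_{n\to\infty} \frac{\log k(n)}{n}>\Lambda^*(x_0)$, then there exists a neighborhood $U$ of $\lambda_0$ in $\mathring{\mathcal D}_\Lambda$ such that, with probability 1, for all $\lambda\in U$, $$\lim_{n\to\infty}\Lambda_n^\omega(\lambda)=\Lambda(\lambda),$$ and $$\lim_{\epsilon\to 0}\lim_{n\to\infty}\frac1n\log\mu_n^\omega([x_0-\epsilon,x_0+\epsilon])=-\Lambda^*(x_0).$$ (2) If $\limsup_{n\to\infty} \frac{\log k(n)}{n}<\Lambda^*(x_0)$ and $\epsilon>0$ is small enough, then with probability 1, for $n$ large enough the set $\{1\le j\le k(n): \Delta S_n(j,\omega)\in[n(x_0-\epsilon),n(x_0+\epsilon)]\}$ is empty. (3) If $\lim_{n\to\infty} \frac{\log k(n)}{n}=\Lambda^*(x_0)$, then, with probability 1, for all $t\ge 1$, $$\lim_{n\to\infty}\Lambda_n^\omega(t\lambda_0)=\Lambda(\lambda_0)+(t-1)\lambda_0x_0.$$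
   Context: $\Lambda^*(x)=\sup_{\lambda\in\mathbb R}\{\lambda x-\Lambda(\lambda)\}$. $S_n=\sum_{i=1}^nX_i$ and, for $n,j\ge1$, $\Delta S_n(j,\omega)=S_{jn}(\omega)-S_{(j-1)n}(\omega)$ (with $S_0=0$). For $\omega\in\Omega$, $n\ge 1$, $\mu_n^\omega$ is the Borel probability measure on $\mathbb R$ given by $$\mu_n^\omega(B)=\frac{\#\{1\le j\le k(n): \Delta S_n(j,\omega)/n\in B\}}{k(n)},$$ and $$\Lambda_n^\omega(\lambda)=\frac1n\log\int_{\mathbb R}\exp(n\lambda x)\,d\mu_n^\omega(x)=\frac1n\log\Big(\frac1{k(n)}\sum_{j=1}^{k(n)}\exp(\lambda\Delta S_n(j,\omega))\Big)\quad(\lambda\in\mathbb R).$$ *)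

theory Defs
  imports "HOL-Probability.Probability"
begin

text \<open>Logarithm on \<open>[0, \<infinity>]\<close>. The real \<^const>\<open>ln\<close> cannot be used where the
  argument may vanish, since \<open>ln 0 = 0\<close> there.\<close>

definition ln_ennreal :: "ennreal \<Rightarrow> ereal" where
  "ln_ennreal x = (if x = 0 then -\<infinity> else if x = \<infinity> then \<infinity> else ereal (ln (enn2real x)))"

lemma ln_ennreal_ennreal: "0 < r \<Longrightarrow> ln_ennreal (ennreal r) = ereal (ln r)"
  by (simp add: ln_ennreal_def ennreal_eq_0_iff)

text \<open>\<open>\<Lambda>(\<lambda>) = log E(exp(\<lambda>Y))\<close>, with value \<open>\<infinity>\<close> where the expectation is infinite.\<close>

definition log_mgf :: "'a measure \<Rightarrow> ('a \<Rightarrow> real) \<Rightarrow> real \<Rightarrow> ereal" where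
  "log_mgf M Y l = ln_ennreal (\<integral>\<^sup>+ \<omega>. ennreal (exp (l * Y \<omega>)) \<partial>M)"

text \<open>Where \<open>L l = \<infinity>\<close>, the term is \<open>-\<infinity>\<close> and does not contribute to the supremum.\<close>

definition legendre :: "(real \<Rightarrow> ereal) \<Rightarrow> real \<Rightarrow> ereal" where
  "legendre L x = (SUP l. ereal (l * x) - L l)"

text \<open>The sequences are indexed from 1; the values \<open>X 0\<close> and \<open>k 0\<close> play no role.\<close>

definition partial_sum :: "(nat \<Rightarrow> 'a \<Rightarrow> real) \<Rightarrow> nat \<Rightarrow> 'a \<Rightarrow> real" where
  "partial_sum X n \<omega> = (\<Sum>i=1..n. X i \<omega>)"

definition block_sum :: "(nat \<Rightarrow> 'a \<Rightarrow> real) \<Rightarrow> nat \<Rightarrow> nat \<Rightarrow> 'a \<Rightarrow> real" where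
  "block_sum X n j \<omega> = partial_sum X (j * n) \<omega> - partial_sum X ((j - 1) * n) \<omega>"

text \<open>The law of \<open>\<Delta>S\<^sub>n(j, \<omega>) / n\<close> for \<open>j\<close> uniform on \<open>{1..k(n)}\<close> and \<open>\<omega>\<close> fixed. The lemmas
  below give the counting formulas for \<open>\<mu>\<^sub>n\<^sup>\<omega>(B)\<close> and \<open>\<Lambda>\<^sub>n\<^sup>\<omega>(\<lambda>)\<close>.\<close>

definition empirical_measure ::
    "(nat \<Rightarrow> 'a \<Rightarrow> real) \<Rightarrow> (nat \<Rightarrow> nat) \<Rightarrow> nat \<Rightarrow> 'a \<Rightarrow> real measure" where
  "empirical_measure X k n \<omega> =
     distr (uniform_count_measure {1..k n}) borel (\<lambda>j. block_sum X n j \<omega> / real n)"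

definition empirical_log_mgf ::
    "(nat \<Rightarrow> 'a \<Rightarrow> real) \<Rightarrow> (nat \<Rightarrow> nat) \<Rightarrow> nat \<Rightarrow> 'a \<Rightarrow> real \<Rightarrow> real" where
  "empirical_log_mgf X k n \<omega> l =
     1 / real n * ln (\<integral>x. exp (real n * l * x) \<partial>empirical_measure X k n \<omega>)"

lemma block_average_measurable:
  "(\<lambda>j. block_sum X n j \<omega> / real n) \<in> uniform_count_measure A \<rightarrow>\<^sub>M borel"
  by (simp add: measurable_def space_uniform_count_measure sets_uniform_count_measure)

lemma emeasure_empirical_measure:
  assumes "B \<in> sets borel"
  shows "emeasure (empirical_measure X k n \<omega>) B =
    real (card {j \<in> {1..k n}. block_sum X n j \<omega> / real n \<in> B}) / real (k n)"
proof -
  have "(\<lambda>j. block_sum X n j \<omega> / real n) -` B \<inter> {1..k n} =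
      {j \<in> {1..k n}. block_sum X n j \<omega> / real n \<in> B}"
    by auto
  then show ?thesis
    using assms emeasure_uniform_count_measure[of "{1..k n}"
        "{j \<in> {1..k n}. block_sum X n j \<omega> / real n \<in> B}"]
    unfolding empirical_measure_def emeasure_distr[OF block_average_measurable assms]
      space_uniform_count_measure
    by (simp add: subset_eq)
qed

lemma prob_space_empirical_measure:
  assumes "k n \<ge> 1"
  shows "prob_space (empirical_measure X k n \<omega>)"
  using assms unfolding empirical_measure_def
  by (intro prob_space.prob_space_distr block_average_measurable prob_space_uniform_count_measure)
    auto

lemma empirical_log_mgf_eq:
  assumes "n \<ge> 1"
  shows "empirical_log_mgf X k n \<omega> l =
    1 / real n * ln (1 / real (k n) * (\<Sum>j=1..k n. exp (l * block_sum X n j \<omega>)))"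
proof -
  have "(\<integral>x. exp (real n * l * x) \<partial>empirical_measure X k n \<omega>) =
      (\<integral>j. exp (real n * l * (block_sum X n j \<omega> / real n)) \<partial>uniform_count_measure {1..k n})"
    unfolding empirical_measure_def
    by (rule integral_distr[OF block_average_measurable]) measurable
  also have "\<dots> = 1 / real (k n) * (\<Sum>j=1..k n. exp (l * block_sum X n j \<omega>))"
    using assms by (simp add: integral_uniform_count_measure)
  finally show ?thesis
    by (simp add: empirical_log_mgf_def)
qed

end

theory Submission
  imports Defs
begin

text \<open>
  Write \<open>G\<close> for the cumulant generating function of \<open>X 1\<close>, \<open>x(\<lambda>) = G'(\<lambda>)\<close> for the mean under
  exponential tilting by \<open>\<lambda>\<close>, and \<open>I(\<lambda>) = \<lambda> x(\<lambda>) - G(\<lambda>)\<close>. Since \<open>G\<close> lies above its tangents,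
  \<open>I(\<lambda>)\<close> is the Legendre transform of \<open>\<Lambda>\<close> at \<open>x(\<lambda>)\<close> (\<open>legendre_tilted_mean\<close>), so all three regimes
  compare the exponential growth rate \<open>c\<close> of the number \<open>k(n)\<close> of blocks with \<open>I(\<lambda>\<^sub>0)\<close>. The block sums
  \<open>\<Delta>S\<^sub>n(j)\<close> are independent in \<open>j\<close>, and \<open>exp(\<lambda> \<Delta>S\<^sub>n(j))\<close> has mean \<open>exp(n G(\<lambda>))\<close>.

  \<^bold>\<open>Convergence where \<open>I(\<lambda>) < c\<close>.\<close> Markov's inequality and Borel-Cantelli bound the empirical
  functions \<open>\<Lambda>\<^sub>n(\<lambda>)\<close> from above by \<open>G(\<lambda>)\<close>. For the lower bound, normalise the
  exponentials to have mean one. Their \<open>r\<close>-th moment is \<open>exp(n (G(r \<lambda>) - r G(\<lambda>)))\<close>, and the derivative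
  of the exponent at \<open>r = 1\<close> is \<open>I(\<lambda>)\<close>; so for \<open>r\<close> slightly above 1 this moment is exponentially
  smaller than \<open>k(n)\<^bsup>r-1\<^esup>\<close>, which is what a law of large numbers for the \<open>k(n)\<close> blocks needs
  (\<open>sum_lower_tail\<close>). Convexity carries the almost sure convergence from rational \<open>\<lambda>\<close> to all
  \<open>\<lambda>\<close> (\<open>AE_empirical_log_mgf_tendsto\<close>).

  \<^bold>\<open>Supercritical growth.\<close> The set \<open>I < c\<close> is then an open neighbourhood of \<open>\<lambda>\<^sub>0\<close>.
  The rates of \<open>\<mu>\<^sub>n[x\<^sub>0 - \<epsilon>, x\<^sub>0 + \<epsilon>]\<close> follow, for fixed \<open>\<omega>\<close>, from the argument of Gaertner and Ellis:
  tilting gives the lower bound near every \<open>x(\<lambda>)\<close>, and the exponential Chebyshev inequality gives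
  the upper bound. To have a limit for every \<open>\<epsilon>\<close> and not only as \<open>\<epsilon>\<close> tends to 0, one needs the smallest
  rate over the whole interval; parameters on the segment from 0 to \<open>\<lambda>\<^sub>0\<close>, along which \<open>I\<close> is nondecreasing,
  provide it (\<open>interval_measure_rate\<close>).

  \<^bold>\<open>Subcritical growth.\<close> A block average near \<open>x\<^sub>0\<close> forces \<open>exp(\<lambda>\<^sub>0 \<Delta>S\<^sub>n(j))\<close> to be of order
  \<open>exp(n \<lambda>\<^sub>0 x\<^sub>0)\<close>, and the expected number of such blocks decays exponentially
  (\<open>AE_no_block_average_near\<close>).

  \<^bold>\<open>Critical growth.\<close> Unless \<open>X 1\<close> is almost surely constant or \<open>\<lambda>\<^sub>0 = 0\<close>, the points \<open>s \<lambda>\<^sub>0\<close> with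
  \<open>0 \<le> s < 1\<close> satisfy \<open>I(s \<lambda>\<^sub>0) < I(\<lambda>\<^sub>0)\<close>, so convergence holds there. A convex function lies
  above the extension of its secants, and this gives the lower bound for \<open>t \<ge> 1\<close>; the upper
  bound comes from \<open>\<Sum> a\<^sub>j\<^bsup>t\<^esup> \<le> (\<Sum> a\<^sub>j)\<^bsup>t\<^esup>\<close> (\<open>AE_empirical_log_mgf_critical\<close>).
\<close>

section \<open>Cumulant generating functions and exponential tilting\<close>

definition cgf :: "'a measure \<Rightarrow> ('a \<Rightarrow> real) \<Rightarrow> real \<Rightarrow> real" where
  "cgf N Y l = ln (\<integral>\<omega>. exp (l * Y \<omega>) \<partial>N)"

text \<open>The mean of \<open>Y\<close> under the probability measure with density proportional to \<open>exp (l * Y)\<close>.\<close>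

definition tilted_mean :: "'a measure \<Rightarrow> ('a \<Rightarrow> real) \<Rightarrow> real \<Rightarrow> real" where
  "tilted_mean N Y l = (\<integral>\<omega>. Y \<omega> * exp (l * Y \<omega>) \<partial>N) / (\<integral>\<omega>. exp (l * Y \<omega>) \<partial>N)"

text \<open>The value of the Legendre transform of the cumulant generating function at the tilted mean, which
is also the relative entropy of the tilted law with respect to the original one.\<close>

definition tilted_rate :: "'a measure \<Rightarrow> ('a \<Rightarrow> real) \<Rightarrow> real \<Rightarrow> real" where
  "tilted_rate N Y l = l * tilted_mean N Y l - cgf N Y l"

text \<open>These bounds dominate the difference quotients of \<open>l \<mapsto> y\<^sup>p exp(l y)\<close> by two exponentials whose
parameters are still in the domain: a polynomial factor costs an arbitrarily small shift of \<open>l\<close>.\<close>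

lemma abs_power_le_exp:
  fixes x d :: real
  assumes "d > 0"
  shows "\<bar>x\<bar> ^ p \<le> fact p / d ^ p * exp (d * \<bar>x\<bar>)"
proof -
  have "(d * \<bar>x\<bar>) ^ p /\<^sub>R fact p \<le> (\<Sum>n. (d * \<bar>x\<bar>) ^ n /\<^sub>R fact n)"
    using assms sum_le_suminf[OF summable_exp_generic, of "{p}" "d * \<bar>x\<bar>"] by simp
  then have "(d * \<bar>x\<bar>) ^ p / fact p \<le> exp (d * \<bar>x\<bar>)"
    by (simp add: exp_def divide_inverse mult.commute)
  then show ?thesis
    using assms by (simp add: field_simps power_mult_distrib)
qed

lemma abs_exp_minus_one_le:
  fixes a :: real
  shows "\<bar>exp a - 1\<bar> \<le> \<bar>a\<bar> * exp \<bar>a\<bar>"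
proof (cases "a \<ge> 0")
  case True
  have "exp a * (1 - a) \<le> exp a * exp (- a)"
    using exp_ge_add_one_self[of "- a"] by (intro mult_left_mono) auto
  then show ?thesis
    using True by (simp add: exp_minus algebra_simps)
next
  case False
  have "1 - exp a \<le> - a"
    using exp_ge_add_one_self[of a] by linarith
  also have "\<dots> \<le> - a * exp (- a)"
    using False by (simp add: mult_le_cancel_left1)
  finally show ?thesis
    using False by simp
qed

lemma exp_add_abs_le:
  fixes l d x :: real
  shows "exp (l * x) * exp (d * \<bar>x\<bar>) \<le> exp ((l + d) * x) + exp ((l - d) * x)"
  by (cases "x \<ge> 0") (auto simp: exp_add[symmetric] algebra_simps)

text \<open>Having the open set \<open>J\<close> as a parameter lets the same facts serve for the law of \<open>X 1\<close>
and, with \<open>J = UNIV\<close>, for the empirical measures.\<close>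

locale exp_moments = prob_space M for M :: "'a measure" +
  fixes Y :: "'a \<Rightarrow> real" and J :: "real set"
  assumes rv[measurable]: "Y \<in> borel_measurable M"
    and open_J: "open J"
    and integrable_exp: "l \<in> J \<Longrightarrow> integrable M (\<lambda>\<omega>. exp (l * Y \<omega>))"
begin

lemma ex_margin:
  assumes "l \<in> J"
  obtains d where "d > 0" "\<And>h. \<bar>h\<bar> \<le> 2 * d \<Longrightarrow> l + h \<in> J"
proof -
  obtain e where e: "e > 0" "ball l e \<subseteq> J"
    using open_J assms open_contains_ball by blast
  show ?thesis
  proof (rule that[of "e / 4"])
    show "l + h \<in> J" if "\<bar>h\<bar> \<le> 2 * (e / 4)" for h
      using that e by (intro subsetD[OF e(2)]) (auto simp: dist_real_def)
  qed (use e in auto)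
qed

lemma integrable_moment:
  assumes "l \<in> J"
  shows "integrable M (\<lambda>\<omega>. Y \<omega> ^ p * exp (l * Y \<omega>))"
proof -
  obtain d where d: "d > 0" "\<And>h. \<bar>h\<bar> \<le> 2 * d \<Longrightarrow> l + h \<in> J"
    using ex_margin[OF assms] by blast
  have "l + d \<in> J" "l - d \<in> J"
    using d(2)[of d] d(2)[of "- d"] d(1) by auto
  then have int: "integrable M (\<lambda>\<omega>. fact p / d ^ p * (exp ((l + d) * Y \<omega>) + exp ((l - d) * Y \<omega>)))"
    by (intro integrable_mult_right Bochner_Integration.integrable_add integrable_exp)
  show ?thesis
  proof (rule Bochner_Integration.integrable_bound[OF int])
    show "AE \<omega> in M. norm (Y \<omega> ^ p * exp (l * Y \<omega>))
        \<le> norm (fact p / d ^ p * (exp ((l + d) * Y \<omega>) + exp ((l - d) * Y \<omega>)))"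
    proof (rule AE_I2)
      fix \<omega>
      have "\<bar>Y \<omega>\<bar> ^ p * exp (l * Y \<omega>) \<le> fact p / d ^ p * exp (d * \<bar>Y \<omega>\<bar>) * exp (l * Y \<omega>)"
        by (intro mult_right_mono abs_power_le_exp d) auto
      also have "\<dots> = fact p / d ^ p * (exp (l * Y \<omega>) * exp (d * \<bar>Y \<omega>\<bar>))"
        by simp
      also have "\<dots> \<le> fact p / d ^ p * (exp ((l + d) * Y \<omega>) + exp ((l - d) * Y \<omega>))"
        using d by (intro mult_left_mono exp_add_abs_le) auto
      finally show "norm (Y \<omega> ^ p * exp (l * Y \<omega>))
          \<le> norm (fact p / d ^ p * (exp ((l + d) * Y \<omega>) + exp ((l - d) * Y \<omega>)))"
        using d by (simp add: abs_mult power_abs)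
    qed
  qed measurable
qed

text \<open>Differentiation under the integral sign, by dominated convergence along sequences. The order \<open>p\<close>
is arbitrary because \<open>p = 0\<close> gives the derivative of the moment generating function and \<open>p = 1\<close>
the continuity of that derivative.\<close>

lemma DERIV_moment:
  assumes "l \<in> J"
  shows "((\<lambda>l. \<integral>\<omega>. Y \<omega> ^ p * exp (l * Y \<omega>) \<partial>M) has_real_derivative
    (\<integral>\<omega>. Y \<omega> ^ Suc p * exp (l * Y \<omega>) \<partial>M)) (at l)"
proof -
  obtain d where d: "d > 0" "\<And>h. \<bar>h\<bar> \<le> 2 * d \<Longrightarrow> l + h \<in> J"
    using ex_margin[OF assms] by blast
  define w where "w \<omega> = fact (Suc p) / d ^ Suc p *
    (exp ((l + 2 * d) * Y \<omega>) + exp ((l - 2 * d) * Y \<omega>))" for \<omega>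
  have "l + 2 * d \<in> J" "l - 2 * d \<in> J"
    using d(2)[of "2 * d"] d(2)[of "- (2 * d)"] d(1) by auto
  then have int_w: "integrable M w"
    unfolding w_def
    by (intro integrable_mult_right Bochner_Integration.integrable_add integrable_exp)
  let ?q = "\<lambda>h \<omega>. Y \<omega> ^ p * (exp ((l + h) * Y \<omega>) - exp (l * Y \<omega>)) / h"
  have bound: "norm (?q h \<omega>) \<le> w \<omega>" if h: "\<bar>h\<bar> \<le> d" "h \<noteq> 0" for h \<omega>
  proof -
    have "norm (?q h \<omega>) = \<bar>Y \<omega>\<bar> ^ p * exp (l * Y \<omega>) * (\<bar>exp (h * Y \<omega>) - 1\<bar> / \<bar>h\<bar>)"
    proof -
      have "?q h \<omega> = Y \<omega> ^ p * exp (l * Y \<omega>) * ((exp (h * Y \<omega>) - 1) / h)"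
        by (simp add: algebra_simps exp_add diff_divide_distrib)
      then show ?thesis
        by (simp only: real_norm_def abs_mult abs_divide power_abs abs_exp_cancel)
    qed
    also have "\<dots> \<le> \<bar>Y \<omega>\<bar> ^ p * exp (l * Y \<omega>) * (\<bar>h * Y \<omega>\<bar> * exp \<bar>h * Y \<omega>\<bar> / \<bar>h\<bar>)"
      by (intro mult_left_mono divide_right_mono abs_exp_minus_one_le) auto
    also have "\<dots> = \<bar>Y \<omega>\<bar> ^ Suc p * (exp (l * Y \<omega>) * exp (\<bar>h\<bar> * \<bar>Y \<omega>\<bar>))"
      using h by (simp add: abs_mult)
    also have "\<dots> \<le> \<bar>Y \<omega>\<bar> ^ Suc p * (exp (l * Y \<omega>) * exp (d * \<bar>Y \<omega>\<bar>))"
      using h by (intro mult_left_mono) (auto intro: mult_right_mono)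
    also have "\<dots> \<le> fact (Suc p) / d ^ Suc p * exp (d * \<bar>Y \<omega>\<bar>) *
        (exp (l * Y \<omega>) * exp (d * \<bar>Y \<omega>\<bar>))"
      by (intro mult_right_mono abs_power_le_exp d) auto
    also have "\<dots> = fact (Suc p) / d ^ Suc p * (exp (l * Y \<omega>) * exp (2 * d * \<bar>Y \<omega>\<bar>))"
    proof -
      have "exp (2 * d * \<bar>Y \<omega>\<bar>) = exp (d * \<bar>Y \<omega>\<bar>) * exp (d * \<bar>Y \<omega>\<bar>)"
        by (simp flip: exp_add)
      then show ?thesis by (simp add: mult_ac)
    qed
    also have "\<dots> \<le> w \<omega>"
      unfolding w_def using d by (intro mult_left_mono exp_add_abs_le) auto
    finally show ?thesis .
  qed
  have "((\<lambda>h. ((\<integral>\<omega>. Y \<omega> ^ p * exp ((l + h) * Y \<omega>) \<partial>M) - (\<integral>\<omega>. Y \<omega> ^ p * exp (l * Y \<omega>) \<partial>M)) / h)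
      \<longlongrightarrow> (\<integral>\<omega>. Y \<omega> ^ Suc p * exp (l * Y \<omega>) \<partial>M)) (at 0)"
    unfolding tendsto_at_iff_sequentially comp_def
  proof (intro allI impI)
    fix h :: "nat \<Rightarrow> real"
    assume h: "\<forall>i. h i \<in> UNIV - {0}" "h \<longlonglongrightarrow> 0"
    have "\<forall>\<^sub>F i in sequentially. \<bar>h i\<bar> < d"
      using h(2) d(1) by (auto simp: tendsto_iff dist_real_def)
    then obtain N where N: "\<And>i. i \<ge> N \<Longrightarrow> \<bar>h i\<bar> < d"
      by (auto simp: eventually_sequentially)
    have "(\<lambda>i. \<integral>\<omega>. ?q (h (i + N)) \<omega> \<partial>M) \<longlonglongrightarrow> (\<integral>\<omega>. Y \<omega> ^ Suc p * exp (l * Y \<omega>) \<partial>M)"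
    proof (rule integral_dominated_convergence[OF _ _ int_w])
      show "AE \<omega> in M. (\<lambda>i. ?q (h (i + N)) \<omega>) \<longlonglongrightarrow> Y \<omega> ^ Suc p * exp (l * Y \<omega>)"
      proof (rule AE_I2)
        fix \<omega>
        have "((\<lambda>l. Y \<omega> ^ p * exp (l * Y \<omega>)) has_real_derivative Y \<omega> ^ Suc p * exp (l * Y \<omega>)) (at l)"
          by (auto intro!: derivative_eq_intros)
        then have "((\<lambda>h. ?q h \<omega>) \<longlongrightarrow> Y \<omega> ^ Suc p * exp (l * Y \<omega>)) (at 0)"
          by (simp add: DERIV_def right_diff_distrib)
        then show "(\<lambda>i. ?q (h (i + N)) \<omega>) \<longlonglongrightarrow> Y \<omega> ^ Suc p * exp (l * Y \<omega>)"
          using h LIMSEQ_ignore_initial_segment[OF h(2), of N]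
          unfolding tendsto_at_iff_sequentially comp_def by auto
      qed
      show "AE \<omega> in M. norm (?q (h (i + N)) \<omega>) \<le> w \<omega>" for i
        using bound N[of "i + N"] h(1) by (intro AE_I2) (auto simp: less_imp_le)
    qed measurable
    moreover have "(\<integral>\<omega>. ?q (h (i + N)) \<omega> \<partial>M) =
        ((\<integral>\<omega>. Y \<omega> ^ p * exp ((l + h (i + N)) * Y \<omega>) \<partial>M) - (\<integral>\<omega>. Y \<omega> ^ p * exp (l * Y \<omega>) \<partial>M)) / h (i + N)" for i
    proof -
      have "l + h (i + N) \<in> J"
        using N[of "i + N"] d by (intro d(2)) auto
      then show ?thesis
        using assms by (simp add: right_diff_distrib integrable_moment)
    qed
    ultimately show "(\<lambda>i. ((\<integral>\<omega>. Y \<omega> ^ p * exp ((l + h i) * Y \<omega>) \<partial>M) -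
        (\<integral>\<omega>. Y \<omega> ^ p * exp (l * Y \<omega>) \<partial>M)) / h i) \<longlonglongrightarrow> (\<integral>\<omega>. Y \<omega> ^ Suc p * exp (l * Y \<omega>) \<partial>M)"
      by - (rule LIMSEQ_offset[where k = N], simp only:)
  qed
  then show ?thesis
    by (simp add: DERIV_def)
qed

lemma exp_moment_pos:
  assumes "integrable M (\<lambda>\<omega>. exp (l * Y \<omega>))"
  shows "0 < (\<integral>\<omega>. exp (l * Y \<omega>) \<partial>M)"
proof -
  have "(\<integral>\<omega>. exp (l * Y \<omega>) \<partial>M) \<noteq> 0"
    using integral_nonneg_eq_0_iff_AE[OF assms] AE_False by auto
  moreover have "0 \<le> (\<integral>\<omega>. exp (l * Y \<omega>) \<partial>M)"
    by (intro integral_nonneg_AE) auto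
  ultimately show ?thesis by linarith
qed

lemma exp_cgf: "integrable M (\<lambda>\<omega>. exp (l * Y \<omega>)) \<Longrightarrow> exp (cgf M Y l) = (\<integral>\<omega>. exp (l * Y \<omega>) \<partial>M)"
  by (simp add: cgf_def exp_moment_pos)

lemma cgf_0 [simp]: "cgf M Y 0 = 0"
  by (simp add: cgf_def prob_space)

lemma tilted_rate_0 [simp]: "tilted_rate M Y 0 = 0"
  by (simp add: tilted_rate_def)

lemma DERIV_cgf:
  assumes "l \<in> J"
  shows "(cgf M Y has_real_derivative tilted_mean M Y l) (at l)"
  using DERIV_moment[OF assms, of 0] exp_moment_pos[OF integrable_exp[OF assms]]
  unfolding cgf_def[abs_def] tilted_mean_def
  by (auto intro!: derivative_eq_intros)

lemma continuous_on_cgf: "continuous_on J (cgf M Y)"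
  using DERIV_cgf DERIV_isCont continuous_at_imp_continuous_on by blast

lemma continuous_on_tilted_mean: "continuous_on J (tilted_mean M Y)"
proof -
  have "isCont (tilted_mean M Y) l" if "l \<in> J" for l
    unfolding tilted_mean_def[abs_def]
    using DERIV_isCont[OF DERIV_moment[OF that, of 0]] DERIV_isCont[OF DERIV_moment[OF that, of 1]]
      exp_moment_pos[OF integrable_exp[OF that]]
    by (intro continuous_intros) auto
  then show ?thesis
    using continuous_at_imp_continuous_on by blast
qed

lemma continuous_on_tilted_rate: "continuous_on J (tilted_rate M Y)"
  unfolding tilted_rate_def[abs_def]
  by (intro continuous_intros continuous_on_cgf continuous_on_tilted_mean)

text \<open>The integral of \<open>exp y - 1 - y\<close> against the tilted weight measures the gap between the cumulant
generating function and its tangent at \<open>l\<close>, because \<open>y\<close> has mean zero under the tilted law. This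
integrand is nonnegative and vanishes only for \<open>y = 0\<close>; so the same identity yields the tangent
inequality and its equality case.\<close>

lemma tilted_exp_excess:
  fixes l m :: real
  defines "y \<equiv> \<lambda>\<omega>. (m - l) * (Y \<omega> - tilted_mean M Y l)"
  assumes l: "l \<in> J" and m: "integrable M (\<lambda>\<omega>. exp (m * Y \<omega>))"
  shows "integrable M (\<lambda>\<omega>. exp (l * Y \<omega>) * (exp (y \<omega>) - 1 - y \<omega>))"
    and "(\<integral>\<omega>. exp (l * Y \<omega>) * (exp (y \<omega>) - 1 - y \<omega>) \<partial>M) =
      exp (cgf M Y m - (m - l) * tilted_mean M Y l) - exp (cgf M Y l)"
proof -
  let ?x = "tilted_mean M Y l"
  have eq: "exp (l * Y \<omega>) * (exp (y \<omega>) - 1 - y \<omega>) =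
      exp (- (m - l) * ?x) * exp (m * Y \<omega>) - exp (l * Y \<omega>)
      - (m - l) * (Y \<omega> * exp (l * Y \<omega>)) + (m - l) * ?x * exp (l * Y \<omega>)" for \<omega>
  proof -
    have "exp (l * Y \<omega>) * exp (y \<omega>) = exp (- (m - l) * ?x) * exp (m * Y \<omega>)"
      unfolding y_def exp_add[symmetric] by (simp add: algebra_simps)
    then show ?thesis
      unfolding right_diff_distrib by (simp add: y_def algebra_simps)
  qed
  have int: "integrable M (\<lambda>\<omega>. exp (l * Y \<omega>))" "integrable M (\<lambda>\<omega>. Y \<omega> * exp (l * Y \<omega>))"
    using integrable_exp[OF l] integrable_moment[OF l, of 1] by auto
  show "integrable M (\<lambda>\<omega>. exp (l * Y \<omega>) * (exp (y \<omega>) - 1 - y \<omega>))"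
    unfolding eq using m int by auto
  have "(\<integral>\<omega>. exp (l * Y \<omega>) * (exp (y \<omega>) - 1 - y \<omega>) \<partial>M) =
      exp (- (m - l) * ?x) * (\<integral>\<omega>. exp (m * Y \<omega>) \<partial>M) - (\<integral>\<omega>. exp (l * Y \<omega>) \<partial>M)
      - (m - l) * (\<integral>\<omega>. Y \<omega> * exp (l * Y \<omega>) \<partial>M) + (m - l) * ?x * (\<integral>\<omega>. exp (l * Y \<omega>) \<partial>M)"
    unfolding eq using m int by simp
  also have "\<dots> = exp (- (m - l) * ?x) * exp (cgf M Y m) - exp (cgf M Y l)"
    using exp_moment_pos[OF int(1)] by (simp add: exp_cgf m int tilted_mean_def)
  also have "\<dots> = exp (cgf M Y m - (m - l) * tilted_mean M Y l) - exp (cgf M Y l)"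
    by (simp add: exp_add[symmetric] algebra_simps)
  finally show "(\<integral>\<omega>. exp (l * Y \<omega>) * (exp (y \<omega>) - 1 - y \<omega>) \<partial>M) =
      exp (cgf M Y m - (m - l) * tilted_mean M Y l) - exp (cgf M Y l)" .
qed

lemma tilted_exp_excess_nonneg: "0 \<le> exp (l * x) * (exp y - 1 - y)" for l x y :: real
proof -
  have "0 \<le> exp y - 1 - y"
    using exp_ge_add_one_self[of y] by linarith
  then show ?thesis by simp
qed

text \<open>The point \<open>m\<close> may lie outside \<open>J\<close>: the supremum in the Legendre transform ranges over all reals.\<close>

lemma cgf_above_tangent:
  assumes "l \<in> J" "integrable M (\<lambda>\<omega>. exp (m * Y \<omega>))"
  shows "cgf M Y l + (m - l) * tilted_mean M Y l \<le> cgf M Y m"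
proof -
  have "0 \<le> exp (cgf M Y m - (m - l) * tilted_mean M Y l) - exp (cgf M Y l)"
    unfolding tilted_exp_excess(2)[OF assms, symmetric]
    by (intro integral_nonneg_AE AE_I2 tilted_exp_excess_nonneg)
  then show ?thesis by simp
qed

lemma cgf_above_tangent_strict:
  assumes l: "l \<in> J" "integrable M (\<lambda>\<omega>. exp (m * Y \<omega>))" and "m \<noteq> l"
    and not_const: "\<not> (AE \<omega> in M. Y \<omega> = tilted_mean M Y l)"
  shows "cgf M Y l + (m - l) * tilted_mean M Y l < cgf M Y m"
proof (rule ccontr)
  let ?y = "\<lambda>\<omega>. (m - l) * (Y \<omega> - tilted_mean M Y l)"
  let ?f = "\<lambda>\<omega>. exp (l * Y \<omega>) * (exp (?y \<omega>) - 1 - ?y \<omega>)"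
  assume "\<not> ?thesis"
  with cgf_above_tangent[OF l] have "cgf M Y m - (m - l) * tilted_mean M Y l = cgf M Y l"
    by simp
  then have "(\<integral>\<omega>. ?f \<omega> \<partial>M) = 0"
    unfolding tilted_exp_excess(2)[OF l] by simp
  moreover have "AE \<omega> in M. 0 \<le> ?f \<omega>"
    by (intro AE_I2 tilted_exp_excess_nonneg)
  ultimately have "AE \<omega> in M. ?f \<omega> = 0"
    using integral_nonneg_eq_0_iff_AE[OF tilted_exp_excess(1)[OF l]] by simp
  then have "AE \<omega> in M. Y \<omega> = tilted_mean M Y l"
  proof eventually_elim
    case (elim \<omega>)
    then have "exp (?y \<omega>) = 1 + ?y \<omega>" by simp
    then have "exp (?y \<omega>) = 1"
      by (metis add_diff_cancel_left' exp_gt_zero ln_exp ln_eq_minus_one)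
    then have "?y \<omega> = 0"
      by simp
    then show ?case using \<open>m \<noteq> l\<close> by simp
  qed
  with not_const show False by simp
qed

lemma log_mgf_eq_cgf:
  assumes "integrable M (\<lambda>\<omega>. exp (l * Y \<omega>))"
  shows "log_mgf M Y l = ereal (cgf M Y l)"
  using assms exp_moment_pos[OF assms]
  by (simp add: log_mgf_def cgf_def nn_integral_eq_integral ln_ennreal_ennreal)

text \<open>By the tangent inequality the supremum is attained at \<open>l\<close>. Points where the exponential moment
is infinite contribute \<open>-\<infinity>\<close>.\<close>

lemma legendre_tilted_mean:
  assumes l: "l \<in> J"
  shows "legendre (log_mgf M Y) (tilted_mean M Y l) = ereal (tilted_rate M Y l)"
proof (rule antisym)
  show "legendre (log_mgf M Y) (tilted_mean M Y l) \<le> ereal (tilted_rate M Y l)"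
    unfolding legendre_def
  proof (rule SUP_least)
    fix m
    show "ereal (m * tilted_mean M Y l) - log_mgf M Y m \<le> ereal (tilted_rate M Y l)"
    proof (cases "integrable M (\<lambda>\<omega>. exp (m * Y \<omega>))")
      case True
      then show ?thesis
        using cgf_above_tangent[OF l True] by (simp add: log_mgf_eq_cgf tilted_rate_def algebra_simps)
    next
      case False
      then have "(\<integral>\<^sup>+ \<omega>. ennreal (exp (m * Y \<omega>)) \<partial>M) = \<infinity>"
        by (simp add: integrable_iff_bounded less_top[symmetric])
      then show ?thesis
        by (simp add: log_mgf_def ln_ennreal_def)
    qed
  qed
  show "ereal (tilted_rate M Y l) \<le> legendre (log_mgf M Y) (tilted_mean M Y l)"
    unfolding legendre_def
    by (rule SUP_upper2[of l]) (simp_all add: log_mgf_eq_cgf integrable_exp l tilted_rate_def)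
qed

lemma tilted_mean_mono:
  assumes "l \<in> J" "m \<in> J"
  shows "0 \<le> (m - l) * (tilted_mean M Y m - tilted_mean M Y l)"
  using cgf_above_tangent[OF assms(1) integrable_exp[OF assms(2)]]
    cgf_above_tangent[OF assms(2) integrable_exp[OF assms(1)]]
  by (simp add: algebra_simps)

text \<open>The difference of the two rates is the sum of two nonnegative terms: \<open>s * l\<close> times the difference of
the tilted means, and the gap at \<open>s * l\<close> between the cumulant generating function and its tangent at
\<open>t * l\<close>. For distinct parameters the gap is positive unless \<open>Y\<close> is almost surely constant.
Parametrising by the factor \<open>s\<close> of a fixed \<open>l\<close> treats both signs of \<open>l\<close> at once.\<close>

lemma tilted_rate_ray_mono:
  assumes "s * l \<in> J" "t * l \<in> J" "0 \<le> s" "s \<le> t"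
  shows "tilted_rate M Y (s * l) \<le> tilted_rate M Y (t * l)"
    and "s < t \<Longrightarrow> l \<noteq> 0 \<Longrightarrow> \<not> (AE \<omega> in M. Y \<omega> = tilted_mean M Y (t * l)) \<Longrightarrow>
      tilted_rate M Y (s * l) < tilted_rate M Y (t * l)"
proof -
  let ?x = "\<lambda>s. tilted_mean M Y (s * l)" and ?G = "\<lambda>s. cgf M Y (s * l)"
  have "0 \<le> s * (l * (?x t - ?x s))"
  proof (cases "s = t")
    case False
    have "0 \<le> (t - s) * (l * (?x t - ?x s))"
      using tilted_mean_mono[OF assms(1,2)] by (simp add: algebra_simps)
    then have "0 \<le> l * (?x t - ?x s)"
      using False assms by (simp add: zero_le_mult_iff)
    then show ?thesis
      using assms by simp
  qed simp
  then have *: "tilted_rate M Y (s * l) - tilted_rate M Y (t * l) \<le> ?G t - ?G s - (t - s) * (l * ?x t)"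
    by (simp add: tilted_rate_def algebra_simps)
  show "tilted_rate M Y (s * l) \<le> tilted_rate M Y (t * l)"
    using * cgf_above_tangent[OF assms(2) integrable_exp[OF assms(1)]]
    by (simp add: algebra_simps)
  show "tilted_rate M Y (s * l) < tilted_rate M Y (t * l)"
    if "s < t" "l \<noteq> 0" "\<not> (AE \<omega> in M. Y \<omega> = tilted_mean M Y (t * l))"
    using * cgf_above_tangent_strict[OF assms(2) integrable_exp[OF assms(1)] _ that(3)] that(1,2)
    by (simp add: algebra_simps)
qed

end

text \<open>Averaging the two tangent inequalities at the intermediate point cancels the slope.\<close>

lemma (in exp_moments) convex_on_cgf:
  assumes "convex J"
  shows "convex_on J (cgf M Y)"
proof (rule convex_onI[OF _ assms])
  fix t a b :: real
  assume t: "0 < t" "t < 1" and ab: "a \<in> J" "b \<in> J"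
  define z where "z = (1 - t) *\<^sub>R a + t *\<^sub>R b"
  have z: "z \<in> J"
    using assms t ab unfolding z_def by (intro convexD) auto
  have "(1 - t) * (cgf M Y z + (a - z) * tilted_mean M Y z) + t * (cgf M Y z + (b - z) * tilted_mean M Y z)
      \<le> (1 - t) * cgf M Y a + t * cgf M Y b"
    using t by (intro add_mono mult_left_mono cgf_above_tangent z integrable_exp ab) auto
  also have "(1 - t) * (cgf M Y z + (a - z) * tilted_mean M Y z) + t * (cgf M Y z + (b - z) * tilted_mean M Y z)
      = cgf M Y z + ((1 - t) * a + t * b - z) * tilted_mean M Y z"
    by (simp add: algebra_simps)
  finally show "cgf M Y ((1 - t) *\<^sub>R a + t *\<^sub>R b) \<le> (1 - t) * cgf M Y a + t * cgf M Y b"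
    by (simp add: z_def)
qed

section \<open>Tail bounds and the first Borel-Cantelli lemma\<close>

text \<open>A substitute for the second-order bound on \<open>exp (- y)\<close> when only a moment of an order \<open>r\<close>
between 1 and 2 is under control.\<close>

lemma exp_minus_le_powr:
  fixes y r :: real
  assumes "0 \<le> y" "1 \<le> r" "r \<le> 2"
  shows "exp (- y) \<le> 1 - y + y powr r"
proof (cases "y \<le> 1")
  case True
  have "exp (- y) \<le> 1 / (1 + y)"
    using exp_ge_add_one_self[of y] assms by (simp add: exp_minus divide_inverse)
  also have "\<dots> \<le> 1 - y + y ^ 2"
  proof -
    have "(1 - y + y ^ 2) * (1 + y) = 1 + y ^ 3"
      by (simp add: algebra_simps power2_eq_square power3_eq_cube)
    then show ?thesis
      using assms by (simp add: pos_divide_le_eq)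
  qed
  also have "y ^ 2 \<le> y powr r"
  proof (cases "y = 0")
    case False
    then have "y powr 2 \<le> y powr r"
      using assms True by (intro powr_mono') auto
    then show ?thesis
      using assms False by simp
  qed simp
  finally show ?thesis by simp
next
  case False
  then have "y powr 1 \<le> y powr r"
    using assms by (intro powr_mono) auto
  moreover have "exp (- y) \<le> 1"
    using assms by simp
  moreover have "y powr 1 = y"
    using False by simp
  ultimately show ?thesis
    by linarith
qed

context prob_space
begin

lemma AE_eventually_not_of_summable:
  assumes meas: "\<And>n. {\<omega> \<in> space M. P n \<omega>} \<in> sets M"
    and bound: "\<forall>\<^sub>F n in sequentially. prob {\<omega> \<in> space M. P n \<omega>} \<le> b n"
    and "summable b"
  shows "AE \<omega> in M. \<forall>\<^sub>F n in sequentially. \<not> P n \<omega>"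
proof -
  have "summable (\<lambda>n. prob {\<omega> \<in> space M. P n \<omega>})"
    using bound by (intro summable_comparison_test_ev[OF _ \<open>summable b\<close>]) simp
  then have "AE \<omega> in M. \<forall>\<^sub>F n in sequentially. \<omega> \<in> space M - {\<omega> \<in> space M. P n \<omega>}"
    using meas by (intro borel_cantelli_AE1) (auto simp: emeasure_eq_measure)
  then show ?thesis
    by eventually_elim (auto elim: eventually_mono)
qed

text \<open>A lower tail bound for sums of independent nonnegative variables of mean one. Nonnegativity keeps
\<open>exp (- s * W i \<omega>)\<close> bounded, and by \<open>exp_minus_le_powr\<close> one moment of order \<open>r\<close> controls its mean.\<close>

lemma sum_lower_tail:
  fixes W :: "'i \<Rightarrow> 'a \<Rightarrow> real"
  assumes fin: "finite I" and indep: "indep_vars (\<lambda>_. borel) W I"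
    and nonneg: "\<And>i \<omega>. i \<in> I \<Longrightarrow> 0 \<le> W i \<omega>"
    and mean: "\<And>i. i \<in> I \<Longrightarrow> integrable M (W i)" "\<And>i. i \<in> I \<Longrightarrow> expectation (W i) = 1"
    and moment: "\<And>i. i \<in> I \<Longrightarrow> integrable M (\<lambda>\<omega>. W i \<omega> powr r)"
      "\<And>i. i \<in> I \<Longrightarrow> expectation (\<lambda>\<omega>. W i \<omega> powr r) = B"
    and r: "1 \<le> r" "r \<le> 2" and s: "0 < s"
  shows "prob {\<omega> \<in> space M. (\<Sum>i\<in>I. W i \<omega>) \<le> real (card I) / 2}
    \<le> exp (- (real (card I) * s * (1 / 2 - s powr (r - 1) * B)))"
proof -
  have meas[measurable]: "W i \<in> borel_measurable M" if "i \<in> I" for i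
    using indep that by (auto simp: indep_vars_def)
  have int: "integrable M (\<lambda>\<omega>. exp (- (s * W i \<omega>)))" if "i \<in> I" for i
    using that s nonneg[OF that] by (intro integrable_const_bound[of _ 1]) auto
  have indep': "indep_vars (\<lambda>_. borel) (\<lambda>i \<omega>. exp (- (s * W i \<omega>))) I"
    by (rule indep_vars_compose2[OF indep]) measurable
  have one: "expectation (\<lambda>\<omega>. exp (- (s * W i \<omega>))) \<le> exp (- s + s powr r * B)" if i: "i \<in> I" for i
  proof -
    have "expectation (\<lambda>\<omega>. exp (- (s * W i \<omega>))) \<le>
        expectation (\<lambda>\<omega>. 1 - s * W i \<omega> + s powr r * W i \<omega> powr r)"
    proof (rule integral_mono[OF int[OF i]])
      show "integrable M (\<lambda>\<omega>. 1 - s * W i \<omega> + s powr r * W i \<omega> powr r)"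
        using mean moment i by auto
      show "exp (- (s * W i \<omega>)) \<le> 1 - s * W i \<omega> + s powr r * W i \<omega> powr r" for \<omega>
        using exp_minus_le_powr[of "s * W i \<omega>" r] s nonneg[OF i, of \<omega>] r by (simp add: powr_mult)
    qed
    also have "\<dots> = 1 + (- s + s powr r * B)"
      using mean moment i by (simp add: prob_space)
    also have "\<dots> \<le> exp (- s + s powr r * B)"
      by (rule exp_ge_add_one_self)
    finally show ?thesis .
  qed
  let ?Z = "\<lambda>\<omega>. \<Prod>i\<in>I. exp (- (s * W i \<omega>))"
  have Z: "?Z \<omega> = exp (- (s * (\<Sum>i\<in>I. W i \<omega>)))" for \<omega>
    using fin by (simp add: exp_sum[symmetric] sum_negf sum_distrib_left)
  have intZ: "integrable M ?Z"
    by (rule indep_vars_integrable[OF fin indep' int])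
  have "prob {\<omega> \<in> space M. (\<Sum>i\<in>I. W i \<omega>) \<le> real (card I) / 2}
      = prob {\<omega> \<in> space M. exp (- (s * (real (card I) / 2))) \<le> ?Z \<omega>}"
    unfolding Z using s by (intro arg_cong[of _ _ prob]) auto
  also have "\<dots> \<le> expectation ?Z / exp (- (s * (real (card I) / 2)))"
    by (rule integral_Markov_inequality_measure[OF intZ, of "{}"]) (auto intro!: prod_nonneg)
  also have "expectation ?Z = (\<Prod>i\<in>I. expectation (\<lambda>\<omega>. exp (- (s * W i \<omega>))))"
    by (rule indep_vars_lebesgue_integral[OF fin indep' int])
  also have "\<dots> \<le> (\<Prod>i\<in>I. exp (- s + s powr r * B))"
    using one by (intro prod_mono conjI integral_nonneg_AE) auto
  also have "\<dots> = exp (real (card I) * (- s + s powr r * B))"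
    by (simp add: exp_of_nat_mult)
  also have "exp (real (card I) * (- s + s powr r * B)) / exp (- (s * (real (card I) / 2))) =
      exp (- (real (card I) * s * (1 / 2 - s powr (r - 1) * B)))"
  proof -
    have "s powr r = s * s powr (r - 1)"
      using s powr_add[of s 1 "r - 1"] by simp
    then show ?thesis
      by (simp add: exp_diff[symmetric] algebra_simps)
  qed
  finally show ?thesis
    by (simp add: divide_right_mono)
qed

end

section \<open>Block sums of an i.i.d. sequence\<close>

lemma block_sum_eq:
  assumes "j \<ge> 1"
  shows "block_sum X n j \<omega> = (\<Sum>i\<in>{(j - 1) * n + 1..j * n}. X i \<omega>)"
proof -
  have "{1..j * n} = {1..(j - 1) * n} \<union> {(j - 1) * n + 1..j * n}"
    using assms by (auto simp: algebra_simps diff_mult_distrib)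
  then have "partial_sum X (j * n) \<omega> =
      partial_sum X ((j - 1) * n) \<omega> + (\<Sum>i\<in>{(j - 1) * n + 1..j * n}. X i \<omega>)"
    unfolding partial_sum_def by (simp add: sum.union_disjoint[symmetric] disjoint_iff)
  then show ?thesis
    by (simp add: block_sum_def)
qed

locale iid_exp_moments = exp_moments M "X 1" J
  for M :: "'a measure" and X :: "nat \<Rightarrow> 'a \<Rightarrow> real" and J :: "real set" +
  assumes indep: "indep_vars (\<lambda>_. borel) X {1..}"
    and ident: "n \<ge> 1 \<Longrightarrow> distr M borel (X n) = distr M borel (X 1)"
begin

abbreviation G :: "real \<Rightarrow> real" where "G \<equiv> cgf M (X 1)"

lemma rv_X: "i \<ge> 1 \<Longrightarrow> X i \<in> borel_measurable M"
  using indep by (auto simp: indep_vars_def)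

lemma exp_X:
  assumes "i \<ge> 1" "l \<in> J"
  shows "integrable M (\<lambda>\<omega>. exp (l * X i \<omega>))" "expectation (\<lambda>\<omega>. exp (l * X i \<omega>)) = exp (G l)"
proof -
  note [measurable] = rv_X[OF assms(1)]
  have "integrable (distr M borel (X 1)) (\<lambda>x. exp (l * x))"
    using integrable_exp[OF assms(2)] by (simp add: integrable_distr_eq del: One_nat_def)
  then show "integrable M (\<lambda>\<omega>. exp (l * X i \<omega>))"
    unfolding ident[OF assms(1), symmetric] by (simp add: integrable_distr_eq)
  have "expectation (\<lambda>\<omega>. exp (l * X i \<omega>)) = (\<integral>x. exp (l * x) \<partial>distr M borel (X i))"
    by (simp add: integral_distr)
  also have "\<dots> = expectation (\<lambda>\<omega>. exp (l * X 1 \<omega>))"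
    unfolding ident[OF assms(1)] by (simp add: integral_distr del: One_nat_def)
  finally show "expectation (\<lambda>\<omega>. exp (l * X i \<omega>)) = exp (G l)"
    using integrable_exp[OF assms(2)] by (simp add: exp_cgf del: One_nat_def)
qed

lemma indep_block_sum: "indep_vars (\<lambda>_. borel) (block_sum X n) {1..}"
proof -
  let ?K = "\<lambda>j. {(j - 1) * n + 1..j * n}"
  have disj: "disjoint_family_on ?K {1..}"
    unfolding disjoint_family_on_def
  proof (intro ballI impI)
    fix i j :: nat
    assume "i \<in> {1..}" "j \<in> {1..}" "i \<noteq> j"
    have *: "i * n \<le> (j - 1) * n" if "i < j" for i j
      using that by (intro mult_right_mono) auto
    show "?K i \<inter> ?K j = {}"
    proof (rule ccontr)
      assume "\<not> ?thesis"
      then obtain x where x: "(i - 1) * n < x" "x \<le> i * n" "(j - 1) * n < x" "x \<le> j * n"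
        by (metis IntE Suc_eq_plus1 Suc_le_eq atLeastAtMost_iff ex_in_conv)
      show False
      proof (cases "i < j")
        case True
        then show False
          using *[OF True] x by linarith
      next
        case False
        then show False
          using *[of j i] x \<open>i \<noteq> j\<close> by linarith
      qed
    qed
  qed
  have "indep_vars (\<lambda>_. borel) (\<lambda>j \<omega>. \<Sum>i\<in>?K j. (restrict (\<lambda>i. X i \<omega>) (?K j)) i) {1..}"
    by (rule indep_vars_compose2[OF indep_vars_restrict[OF indep _ disj],
          where Y = "\<lambda>j f. \<Sum>i\<in>?K j. f i"]) (auto simp: comp_def)
  also have "?this \<longleftrightarrow> ?thesis"
    by (intro indep_vars_cong) (auto simp: block_sum_eq fun_eq_iff)
  finally show ?thesis .
qed

lemma rv_block_sum: "j \<ge> 1 \<Longrightarrow> block_sum X n j \<in> borel_measurable M"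
  using indep_block_sum[of n] by (auto simp: indep_vars_def)

lemma exp_block_sum:
  assumes "j \<ge> 1" "l \<in> J"
  shows "integrable M (\<lambda>\<omega>. exp (l * block_sum X n j \<omega>))"
    and "expectation (\<lambda>\<omega>. exp (l * block_sum X n j \<omega>)) = exp (real n * G l)"
proof -
  let ?K = "{(j - 1) * n + 1..j * n}"
  have eq: "exp (l * block_sum X n j \<omega>) = (\<Prod>i\<in>?K. exp (l * X i \<omega>))" for \<omega>
    using assms by (simp add: block_sum_eq exp_sum[symmetric] sum_distrib_left)
  have ind: "indep_vars (\<lambda>_. borel) (\<lambda>i \<omega>. exp (l * X i \<omega>)) ?K"
    by (rule indep_vars_compose2[OF indep_vars_subset[OF indep]]) auto
  have int: "integrable M (\<lambda>\<omega>. exp (l * X i \<omega>))" if "i \<in> ?K" for i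
    using that assms by (intro exp_X) auto
  show "integrable M (\<lambda>\<omega>. exp (l * block_sum X n j \<omega>))"
    unfolding eq by (rule indep_vars_integrable[OF _ ind int]) auto
  have "expectation (\<lambda>\<omega>. exp (l * block_sum X n j \<omega>)) =
      (\<Prod>i\<in>?K. expectation (\<lambda>\<omega>. exp (l * X i \<omega>)))"
    unfolding eq by (rule indep_vars_lebesgue_integral[OF _ ind int]) auto
  also have "\<dots> = (\<Prod>i\<in>?K. exp (G l))"
    using assms by (intro prod.cong refl exp_X) auto
  also have "\<dots> = exp (real n * G l)"
    using assms by (simp add: exp_of_nat_mult[symmetric] diff_mult_distrib)
  finally show "expectation (\<lambda>\<omega>. exp (l * block_sum X n j \<omega>)) = exp (real n * G l)" .
qed

lemma prob_sum_exp_block_ge: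
  assumes "l \<in> J" "a > 0"
  shows "prob {\<omega> \<in> space M. a \<le> (\<Sum>j=1..k. exp (l * block_sum X n j \<omega>))}
    \<le> real k * exp (real n * G l) / a"
proof -
  have int: "integrable M (\<lambda>\<omega>. \<Sum>j=1..k. exp (l * block_sum X n j \<omega>))"
    using assms by (intro Bochner_Integration.integrable_sum exp_block_sum) auto
  have "prob {\<omega> \<in> space M. a \<le> (\<Sum>j=1..k. exp (l * block_sum X n j \<omega>))}
      \<le> expectation (\<lambda>\<omega>. \<Sum>j=1..k. exp (l * block_sum X n j \<omega>)) / a"
    using assms by (intro integral_Markov_inequality_measure[OF int, of "{}"]) (auto intro!: sum_nonneg)
  also have "expectation (\<lambda>\<omega>. \<Sum>j=1..k. exp (l * block_sum X n j \<omega>)) = real k * exp (real n * G l)"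
    using assms by (subst Bochner_Integration.integral_sum) (auto simp: exp_block_sum)
  finally show ?thesis .
qed

lemma measurable_sum_exp_block:
  "(\<lambda>\<omega>. \<Sum>j=1..k. exp (l * block_sum X n j \<omega>)) \<in> borel_measurable M"
proof (rule borel_measurable_sum)
  fix j assume "j \<in> {1..k}"
  then have [measurable]: "block_sum X n j \<in> borel_measurable M"
    by (intro rv_block_sum) auto
  show "(\<lambda>\<omega>. exp (l * block_sum X n j \<omega>)) \<in> borel_measurable M"
    by measurable
qed

text \<open>Moves between the normalised logarithm and the sum of exponentials, to which the tail bounds apply.\<close>

lemma empirical_log_mgf_bound_iff:
  fixes a :: real
  assumes "n \<ge> 1" "k n \<ge> 1"
  shows "empirical_log_mgf X k n \<omega> l < a \<longleftrightarrow>
      (\<Sum>j=1..k n. exp (l * block_sum X n j \<omega>)) < real (k n) * exp (real n * a)" (is ?thesis1)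
    and "a < empirical_log_mgf X k n \<omega> l \<longleftrightarrow>
      real (k n) * exp (real n * a) < (\<Sum>j=1..k n. exp (l * block_sum X n j \<omega>))" (is ?thesis2)
proof -
  let ?S = "\<Sum>j=1..k n. exp (l * block_sum X n j \<omega>)"
  let ?F = "empirical_log_mgf X k n \<omega> l"
  have "0 < ?S"
    using assms by (intro sum_pos) auto
  then have "ln (1 / real (k n) * ?S) = real n * ?F"
    using assms by (simp add: empirical_log_mgf_eq)
  moreover have "0 < 1 / real (k n) * ?S"
    using \<open>0 < ?S\<close> assms by simp
  ultimately have "exp (real n * ?F) = 1 / real (k n) * ?S"
    by (metis exp_ln)
  then have S: "?S = real (k n) * exp (real n * ?F)"
    using assms by (simp add: field_simps)
  show ?thesis1 ?thesis2
    unfolding S using assms by simp_all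
qed

text \<open>The average of the \<open>exp (l * block_sum X n j \<omega>)\<close> has mean \<open>exp (n G(l))\<close>, and exceeding it by a factor
\<open>exp (n \<delta>)\<close> has probability at most \<open>exp (- n \<delta>)\<close>.\<close>

lemma AE_empirical_log_mgf_upper:
  assumes k: "\<And>n. n \<ge> 1 \<Longrightarrow> k n \<ge> 1" and l: "l \<in> J" and "\<delta> > 0"
  shows "AE \<omega> in M. \<forall>\<^sub>F n in sequentially. empirical_log_mgf X k n \<omega> l < G l + \<delta>"
proof -
  let ?S = "\<lambda>n \<omega>. \<Sum>j=1..k n. exp (l * block_sum X n j \<omega>)"
  let ?a = "\<lambda>n. real (k n) * exp (real n * (G l + \<delta>))"
  have "AE \<omega> in M. \<forall>\<^sub>F n in sequentially. \<not> ?a n \<le> ?S n \<omega>"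
  proof (rule AE_eventually_not_of_summable)
    show "{\<omega> \<in> space M. ?a n \<le> ?S n \<omega>} \<in> sets M" for n
      using measurable_sum_exp_block by measurable
    show "\<forall>\<^sub>F n in sequentially. prob {\<omega> \<in> space M. ?a n \<le> ?S n \<omega>} \<le> exp (- \<delta>) ^ n"
      using eventually_ge_at_top[of 1]
    proof eventually_elim
      case (elim n)
      have "prob {\<omega> \<in> space M. ?a n \<le> ?S n \<omega>} \<le> real (k n) * exp (real n * G l) / ?a n"
        using k[OF elim] by (intro prob_sum_exp_block_ge l) auto
      also have "\<dots> = exp (real n * (- \<delta>))"
        using k[OF elim] by (simp add: distrib_left exp_add exp_minus field_simps)
      finally show ?case
        unfolding exp_of_nat_mult[of n "- \<delta>"] .
    qed
    show "summable (\<lambda>n. exp (- \<delta>) ^ n)"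
      using \<open>\<delta> > 0\<close> by (intro summable_geometric) auto
  qed
  then show ?thesis
  proof eventually_elim
    case (elim \<omega>)
    with eventually_ge_at_top[of 1] show ?case
    proof eventually_elim
      case (elim n)
      then show ?case
        using k[of n] by (simp add: empirical_log_mgf_bound_iff not_le)
    qed
  qed
qed

text \<open>If a block average is within \<open>\<epsilon>\<close> of \<open>x\<close>, a single term of the sum of exponentials already exceeds
\<open>exp (n (l x - \<bar>l\<bar> \<epsilon>))\<close>. Markov's inequality bounds the probability of this by
\<open>k(n) exp (n (G(l) - l x + \<bar>l\<bar> \<epsilon>))\<close>, which is summable if \<open>k(n) \<le> exp (c n)\<close> with \<open>c\<close> as assumed.\<close>

lemma AE_no_block_average_near:
  assumes k: "\<And>n. n \<ge> 1 \<Longrightarrow> k n \<ge> 1" and l: "l \<in> J"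
    and c: "\<forall>\<^sub>F n in sequentially. ln (real (k n)) / real n \<le> c"
    and less: "c < l * x - G l - \<bar>l\<bar> * \<epsilon>"
  shows "AE \<omega> in M. \<forall>\<^sub>F n in sequentially.
    {j \<in> {1..k n}. block_sum X n j \<omega> \<in> {real n * (x - \<epsilon>)..real n * (x + \<epsilon>)}} = {}"
proof -
  let ?S = "\<lambda>n \<omega>. \<Sum>j=1..k n. exp (l * block_sum X n j \<omega>)"
  let ?a = "\<lambda>n. exp (real n * (l * x - \<bar>l\<bar> * \<epsilon>))"
  define \<eta> where "\<eta> = l * x - G l - \<bar>l\<bar> * \<epsilon> - c"
  have "\<eta> > 0"
    using less by (simp add: \<eta>_def)
  have "AE \<omega> in M. \<forall>\<^sub>F n in sequentially. \<not> ?a n \<le> ?S n \<omega>"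
  proof (rule AE_eventually_not_of_summable)
    show "{\<omega> \<in> space M. ?a n \<le> ?S n \<omega>} \<in> sets M" for n
      using measurable_sum_exp_block by measurable
    show "\<forall>\<^sub>F n in sequentially. prob {\<omega> \<in> space M. ?a n \<le> ?S n \<omega>} \<le> exp (- \<eta>) ^ n"
      using eventually_ge_at_top[of 1] c
    proof eventually_elim
      case (elim n)
      have "real (k n) = exp (ln (real (k n)))"
        using k[OF elim(1)] by simp
      also have "\<dots> \<le> exp (real n * c)"
        using elim by (simp add: pos_divide_le_eq mult.commute)
      finally have kn: "real (k n) \<le> exp (real n * c)" .
      have "prob {\<omega> \<in> space M. ?a n \<le> ?S n \<omega>} \<le> real (k n) * exp (real n * G l) / ?a n"
        by (intro prob_sum_exp_block_ge l) auto
      also have "\<dots> \<le> exp (real n * c) * exp (real n * G l) / ?a n"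
        using kn by (intro divide_right_mono mult_right_mono) auto
      also have "\<dots> = exp (real n * (- \<eta>))"
        by (simp add: \<eta>_def exp_add[symmetric] exp_diff[symmetric] algebra_simps)
      finally show ?case
        unfolding exp_of_nat_mult[of n "- \<eta>"] .
    qed
    show "summable (\<lambda>n. exp (- \<eta>) ^ n)"
      using \<open>\<eta> > 0\<close> by (intro summable_geometric) auto
  qed
  then show ?thesis
  proof eventually_elim
    case (elim \<omega>)
    then show ?case
    proof eventually_elim
      case (elim n)
      show ?case
      proof (rule ccontr)
        assume "\<not> ?thesis"
        then obtain j where j: "j \<in> {1..k n}" "\<bar>block_sum X n j \<omega> - real n * x\<bar> \<le> real n * \<epsilon>"
          by (auto simp: abs_le_iff algebra_simps)
        have "\<bar>l * (block_sum X n j \<omega> - real n * x)\<bar> \<le> \<bar>l\<bar> * (real n * \<epsilon>)"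
          unfolding abs_mult using j by (intro mult_left_mono) auto
        then have "real n * (l * x - \<bar>l\<bar> * \<epsilon>) \<le> l * block_sum X n j \<omega>"
          by (simp add: abs_le_iff algebra_simps)
        then have "?a n \<le> exp (l * block_sum X n j \<omega>)"
          by simp
        also have "\<dots> \<le> ?S n \<omega>"
          using j by (intro member_le_sum) auto
        finally show False
          using elim by simp
      qed
    qed
  qed
qed

text \<open>The function \<open>r \<mapsto> G (r l) - r G(l) - (r - 1) c\<close> vanishes at \<open>r = 1\<close> and has there the derivative
\<open>tilted_rate M (X 1) l - c < 0\<close>.\<close>

lemma ex_moment_exponent:
  assumes l: "l \<in> J" and c: "tilted_rate M (X 1) l < c"
  obtains r where "1 < r" "r \<le> 2" "r * l \<in> J" "G (r * l) - r * G l < (r - 1) * c"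
proof -
  let ?f = "\<lambda>r. G (r * l) - r * G l - (r - 1) * c"
  have "(G has_real_derivative tilted_mean M (X 1) l) (at (1 * l))"
    using DERIV_cgf[OF l] by simp
  from DERIV_chain'[OF DERIV_cmult_right[OF DERIV_ident] this]
  have "((\<lambda>r. G (r * l)) has_real_derivative tilted_mean M (X 1) l * l) (at 1)"
    by (simp add: mult.commute)
  then have "(?f has_real_derivative (tilted_mean M (X 1) l * l - G l - c)) (at 1)"
    by (auto intro!: derivative_eq_intros)
  moreover have "tilted_mean M (X 1) l * l - G l - c < 0"
    using c by (simp add: tilted_rate_def mult.commute)
  ultimately obtain d1 where d1: "d1 > 0" "\<And>h. 0 < h \<Longrightarrow> h < d1 \<Longrightarrow> ?f (1 + h) < ?f 1"
    using DERIV_neg_dec_right by blast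
  obtain d2 where d2: "d2 > 0" "\<And>h. \<bar>h\<bar> \<le> 2 * d2 \<Longrightarrow> l + h \<in> J"
    using ex_margin[OF l] by blast
  define h where "h = min (d1 / 2) (min 1 (d2 / (\<bar>l\<bar> + 1)))"
  have h: "0 < h" "h < d1" "h \<le> 1" "h \<le> d2 / (\<bar>l\<bar> + 1)"
    using d1(1) d2(1) by (auto simp: h_def add_nonneg_pos)
  have "\<bar>h * l\<bar> \<le> h * (\<bar>l\<bar> + 1)"
    using h by (simp add: abs_mult)
  also have "\<dots> \<le> d2"
    using h(4) by (simp add: pos_le_divide_eq add_nonneg_pos)
  finally have "l + h * l \<in> J"
    using d2(1) by (intro d2(2)) simp
  then have "(1 + h) * l \<in> J"
    by (simp add: algebra_simps)
  then show ?thesis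
    using d1(2)[OF h(1,2)] h by (intro that[of "1 + h"]) auto
qed

text \<open>Law of large numbers for the normalised exponentials. Their \<open>r\<close>-th moment may grow with \<open>n\<close>, but
exponentially more slowly than \<open>k(n)\<close> to the power \<open>r - 1\<close>, so their average stays above \<open>1 / 2\<close>
eventually; the factor \<open>1 / 2\<close> disappears on the exponential scale.\<close>

lemma AE_empirical_log_mgf_lower:
  assumes k: "\<And>n. n \<ge> 1 \<Longrightarrow> k n \<ge> 1" and l: "l \<in> J"
    and c: "tilted_rate M (X 1) l < c" "\<forall>\<^sub>F n in sequentially. c \<le> ln (real (k n)) / real n"
    and "\<delta> > 0"
  shows "AE \<omega> in M. \<forall>\<^sub>F n in sequentially. G l - \<delta> < empirical_log_mgf X k n \<omega> l"
proof -
  obtain r where r: "1 < r" "r \<le> 2" "r * l \<in> J" "G (r * l) - r * G l < (r - 1) * c"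
    using ex_moment_exponent[OF l c(1)] by blast
  define \<eta> where "\<eta> = (r - 1) * c - (G (r * l) - r * G l)"
  define W where "W n j \<omega> = exp (l * block_sum X n j \<omega> - real n * G l)" for n j \<omega>
  have "\<eta> > 0"
    using r by (simp add: \<eta>_def)
  have ind: "indep_vars (\<lambda>_. borel) (W n) {1..k n}" for n
    unfolding W_def
    by (rule indep_vars_compose2[OF indep_vars_subset[OF indep_block_sum]]) auto
  have W_nonneg: "0 \<le> W n j \<omega>" for n j \<omega>
    by (simp add: W_def)
  have W: "integrable M (W n j)" "expectation (W n j) = 1" if "j \<in> {1..k n}" for n j
    using that exp_block_sum[of j l n] l by (simp_all add: W_def[abs_def] exp_diff)
  have Wr_eq: "W n j \<omega> powr r = exp (r * l * block_sum X n j \<omega>) * exp (- (r * (real n * G l)))" for n j \<omega>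
    by (simp add: W_def powr_def exp_add[symmetric] algebra_simps)
  have Wr: "integrable M (\<lambda>\<omega>. W n j \<omega> powr r)"
      "expectation (\<lambda>\<omega>. W n j \<omega> powr r) = exp (real n * (G (r * l) - r * G l))"
    if "j \<in> {1..k n}" for n j
  proof -
    have j: "1 \<le> j"
      using that by simp
    show "integrable M (\<lambda>\<omega>. W n j \<omega> powr r)"
      unfolding Wr_eq by (intro integrable_mult_left exp_block_sum j r)
    have "expectation (\<lambda>\<omega>. W n j \<omega> powr r) = exp (real n * G (r * l)) * exp (- (r * (real n * G l)))"
      using exp_block_sum[OF j r(3), of n] unfolding Wr_eq by simp
    then show "expectation (\<lambda>\<omega>. W n j \<omega> powr r) = exp (real n * (G (r * l) - r * G l))"
      by (simp add: exp_add[symmetric] algebra_simps)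
  qed
  have "AE \<omega> in M. \<forall>\<^sub>F n in sequentially. \<not> (\<Sum>j\<in>{1..k n}. W n j \<omega>) \<le> real (card {1..k n}) / 2"
  proof (rule AE_eventually_not_of_summable)
    have [measurable]: "(\<lambda>\<omega>. \<Sum>j\<in>{1..k n}. W n j \<omega>) \<in> borel_measurable M" for n
      using W by (intro borel_measurable_sum) auto
    show "{\<omega> \<in> space M. (\<Sum>j\<in>{1..k n}. W n j \<omega>) \<le> real (card {1..k n}) / 2} \<in> sets M" for n
      by measurable
    have "(\<lambda>n. real n * exp (- \<eta>) ^ n) \<longlonglongrightarrow> 0"
      using \<open>\<eta> > 0\<close> by (intro powser_times_n_limit_0) auto
    then have "\<forall>\<^sub>F n in sequentially. real n * exp (- \<eta>) ^ n < 1 / 4"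
      by (rule order_tendstoD) auto
    with eventually_ge_at_top[of 1] c(2)
    show "\<forall>\<^sub>F n in sequentially. prob {\<omega> \<in> space M. (\<Sum>j\<in>{1..k n}. W n j \<omega>) \<le> real (card {1..k n}) / 2}
      \<le> exp (- (1 / 4)) ^ n"
    proof eventually_elim
      case (elim n)
      \<comment> \<open>With this \<open>s\<close> the tail bound decays exponentially in \<open>n\<close>: the product of \<open>s\<close> and the number of
        blocks is \<open>n\<close>, while \<open>s powr (r - 1)\<close> times the moment is at most \<open>n exp (- \<eta> n)\<close>.\<close>
      define s where "s = real n / real (k n)"
      have kn: "real (k n) \<ge> 1"
        using k[OF elim(1)] by simp
      then have "s > 0"
        using elim by (simp add: s_def)
      have "s powr (r - 1) * exp (real n * (G (r * l) - r * G l))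
          = real n powr (r - 1) * exp (real n * (G (r * l) - r * G l) - (r - 1) * ln (real (k n)))"
      proof -
        have "s powr (r - 1) = real n powr (r - 1) / real (k n) powr (r - 1)"
          by (simp add: s_def powr_divide)
        moreover have "real (k n) powr (r - 1) = exp ((r - 1) * ln (real (k n)))"
          using kn by (simp add: powr_def)
        ultimately show ?thesis
          by (simp add: exp_diff)
      qed
      also have "\<dots> \<le> real n powr 1 * exp (real n * (G (r * l) - r * G l) - (r - 1) * (real n * c))"
        using elim r by (intro mult_mono powr_mono) (auto simp: pos_le_divide_eq mult.commute)
      also have "\<dots> = real n * exp (real n * (- \<eta>))"
        using elim by (simp add: \<eta>_def algebra_simps)
      also have "\<dots> < 1 / 4"
        using elim unfolding exp_of_nat_mult by simp
      finally have small: "s powr (r - 1) * exp (real n * (G (r * l) - r * G l)) < 1 / 4" .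
      have "prob {\<omega> \<in> space M. (\<Sum>j\<in>{1..k n}. W n j \<omega>) \<le> real (card {1..k n}) / 2}
          \<le> exp (- (real (card {1..k n}) * s * (1 / 2 - s powr (r - 1) * exp (real n * (G (r * l) - r * G l)))))"
        using r \<open>s > 0\<close> W Wr by (intro sum_lower_tail ind) (auto simp: W_nonneg)
      also have "real (card {1..k n}) * s = real n"
        using kn by (simp add: s_def)
      also have "exp (- (real n * (1 / 2 - s powr (r - 1) * exp (real n * (G (r * l) - r * G l)))))
          \<le> exp (- (real n * (1 / 4)))"
        using small by (intro iffD2[OF exp_le_cancel_iff] le_imp_neg_le mult_left_mono) auto
      also have "\<dots> = exp (- (1 / 4)) ^ n"
        by (simp add: exp_of_nat_mult[symmetric])
      finally show ?case .
    qed
    show "summable (\<lambda>n. exp (- (1 / 4 :: real)) ^ n)"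
      by (intro summable_geometric) auto
  qed
  then show ?thesis
  proof eventually_elim
    case (elim \<omega>)
    have "\<forall>\<^sub>F n in sequentially. ln 2 / \<delta> \<le> real n"
      using filterlim_real_sequentially by (auto simp: filterlim_at_top)
    with elim eventually_ge_at_top[of 1] show ?case
    proof eventually_elim
      case (elim n)
      have "real (k n) * exp (real n * (G l - \<delta>)) \<le> real (k n) / 2 * exp (real n * G l)"
      proof -
        have "exp (real n * (G l - \<delta>)) = exp (real n * G l) / exp (real n * \<delta>)"
          by (simp add: algebra_simps exp_diff)
        also have "\<dots> \<le> exp (real n * G l) / exp (ln 2)"
        proof (intro divide_left_mono)
          have "ln 2 \<le> real n * \<delta>"
            using elim \<open>\<delta> > 0\<close> by (simp add: pos_divide_le_eq)
          then show "exp (ln 2) \<le> exp (real n * \<delta>)"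
            by (simp only: exp_le_cancel_iff)
        qed auto
        finally have "real (k n) * exp (real n * (G l - \<delta>)) \<le> real (k n) * (exp (real n * G l) / exp (ln 2))"
          by (rule mult_left_mono) simp
        then show ?thesis
          by simp
      qed
      also have "\<dots> < (\<Sum>j\<in>{1..k n}. W n j \<omega>) * exp (real n * G l)"
        using elim by (intro mult_strict_right_mono) auto
      also have "\<dots> = (\<Sum>j\<in>{1..k n}. exp (l * block_sum X n j \<omega>))"
        by (simp add: W_def sum_distrib_right exp_diff)
      finally show ?case
        using elim k by (simp add: empirical_log_mgf_bound_iff)
    qed
  qed
qed

end

section \<open>Almost sure convergence of the empirical log moment generating functions\<close>

text \<open>Convexity prevents oscillation between rational points. The upper bound at \<open>l\<close> interpolates between
rational points on both sides. For the lower bound, a rational \<open>a\<close> lies between another rational \<open>a'\<close>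
and \<open>l\<close>, so a small value at \<open>l\<close> would pull down the value at \<open>a\<close>.\<close>

lemma convex_pointwise_limit_of_rationals:
  fixes f :: "nat \<Rightarrow> real \<Rightarrow> real"
  assumes convex: "\<forall>\<^sub>F n in sequentially. convex_on UNIV (f n)"
    and V: "open V" "continuous_on V g" and l: "l \<in> V"
    and rat: "\<And>q. q \<in> V \<inter> \<rat> \<Longrightarrow> (\<lambda>n. f n q) \<longlonglongrightarrow> g q"
  shows "(\<lambda>n. f n l) \<longlonglongrightarrow> g l"
proof (rule tendstoI)
  fix \<delta> :: real
  assume "\<delta> > 0"
  define \<eta> where "\<eta> = \<delta> / 4"
  have "\<eta> > 0"
    using \<open>\<delta> > 0\<close> by (simp add: \<eta>_def)
  have "isCont g l"
    using V l continuous_on_eq_continuous_at by blast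
  then have "\<forall>\<^sub>F y in nhds l. \<bar>g y - g l\<bar> < \<eta> / 2"
    using \<open>\<eta> > 0\<close> tendstoD[of g "g l" "nhds l" "\<eta> / 2"]
    by (simp add: isCont_def tendsto_at_iff_tendsto_nhds dist_real_def)
  moreover have "\<forall>\<^sub>F y in nhds l. y \<in> V"
    using V l by (simp add: eventually_nhds_in_open)
  ultimately have "\<forall>\<^sub>F y in nhds l. y \<in> V \<and> \<bar>g y - g l\<bar> < \<eta> / 2"
    by eventually_elim simp
  then obtain \<rho> where \<rho>: "\<rho> > 0" "\<And>y. \<bar>y - l\<bar> < \<rho> \<Longrightarrow> y \<in> V" "\<And>y. \<bar>y - l\<bar> < \<rho> \<Longrightarrow> \<bar>g y - g l\<bar> < \<eta> / 2"
    unfolding eventually_nhds_metric dist_real_def by blast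
  obtain a' where a': "a' \<in> \<rat>" "l - \<rho> < a'" "a' < l"
    using Rats_dense_in_real[of "l - \<rho>" l] \<rho>(1) by auto
  \<comment> \<open>The point \<open>a\<close> is closer to \<open>l\<close> than to \<open>a'\<close>, so that \<open>l\<close> has weight at least \<open>1 / 2\<close> when \<open>a\<close> is
    written as a convex combination of \<open>a'\<close> and \<open>l\<close>.\<close>
  obtain a where a: "a \<in> \<rat>" "(a' + l) / 2 < a" "a < l"
    using Rats_dense_in_real[of "(a' + l) / 2" l] a' by auto
  obtain b where b: "b \<in> \<rat>" "l < b" "b < l + \<rho>"
    using Rats_dense_in_real[of l "l + \<rho>"] \<rho>(1) by auto
  have near: "\<forall>\<^sub>F n in sequentially. \<bar>f n q - g l\<bar> < \<eta>" if "q \<in> \<rat>" "\<bar>q - l\<bar> < \<rho>" for q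
  proof -
    have "\<forall>\<^sub>F n in sequentially. \<bar>f n q - g q\<bar> < \<eta> / 2"
      using tendstoD[OF rat, of q "\<eta> / 2"] that \<rho>(2) \<open>\<eta> > 0\<close> by (simp add: dist_real_def)
    then show ?thesis
      by eventually_elim (use \<rho>(3)[OF that(2)] in linarith)
  qed
  have "\<forall>\<^sub>F n in sequentially. \<bar>f n a' - g l\<bar> < \<eta>" "\<forall>\<^sub>F n in sequentially. \<bar>f n a - g l\<bar> < \<eta>"
    "\<forall>\<^sub>F n in sequentially. \<bar>f n b - g l\<bar> < \<eta>"
    using a' a b by (intro near; simp)+
  with convex show "\<forall>\<^sub>F n in sequentially. dist (f n l) (g l) < \<delta>"
  proof eventually_elim
    case (elim n)
    define u where "u = (l - a) / (b - a)"
    have "u * (b - a) = l - a"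
      using a b by (simp add: u_def)
    then have u: "l = (1 - u) *\<^sub>R a + u *\<^sub>R b" "0 \<le> u" "u \<le> 1"
      using a b by (simp add: algebra_simps) (use a b in \<open>auto simp: u_def field_simps\<close>)
    have "f n l \<le> (1 - u) * f n a + u * f n b"
      using convex_onD[OF elim(1) u(2,3), of a b] u(1) by simp
    also have "\<dots> \<le> (1 - u) * (g l + \<eta>) + u * (g l + \<eta>)"
      using elim u by (intro add_mono mult_left_mono) auto
    also have "\<dots> = g l + \<eta>"
      by (simp add: algebra_simps)
    finally have upper: "f n l \<le> g l + \<eta>" .
    define v where "v = (a - a') / (l - a')"
    have "v * (l - a') = a - a'"
      using a a' by (simp add: v_def)
    then have v: "a = (1 - v) *\<^sub>R a' + v *\<^sub>R l" "1 / 2 \<le> v" "v \<le> 1"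
      using a a' by (simp add: algebra_simps) (use a a' in \<open>auto simp: v_def field_simps\<close>)
    have "g l - \<eta> < f n a"
      using elim by linarith
    also have "\<dots> \<le> (1 - v) * f n a' + v * f n l"
      using convex_onD[OF elim(1) _ v(3), of a' l] v by simp
    also have "\<dots> \<le> (1 - v) * (g l + \<eta>) + v * f n l"
      using elim v by (intro add_mono mult_left_mono) auto
    finally have "- ((2 - v) * \<eta>) < v * (f n l - g l)"
      by (simp add: algebra_simps)
    moreover have "(2 - v) * \<eta> \<le> v * (4 * \<eta>)"
      using v(2) \<open>\<eta> > 0\<close> mult_right_mono[of "2 - v" "v * 4" \<eta>] by (simp add: algebra_simps)
    ultimately have "v * (- (4 * \<eta>)) < v * (f n l - g l)"
      by simp
    then have lower: "- (4 * \<eta>) < f n l - g l"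
      using v(2) by (subst (asm) mult_less_cancel_left_pos) auto
    show ?case
      using lower upper \<open>\<eta> > 0\<close> by (simp add: dist_real_def abs_less_iff \<eta>_def)
  qed
qed

lemma exp_moments_empirical_measure:
  assumes "k n \<ge> 1"
  shows "exp_moments (empirical_measure X k n \<omega>) (\<lambda>x. x) UNIV"
proof -
  interpret prob_space "empirical_measure X k n \<omega>"
    using assms by (rule prob_space_empirical_measure)
  show ?thesis
  proof
    show "(\<lambda>x. x) \<in> borel_measurable (empirical_measure X k n \<omega>)"
      by (simp add: empirical_measure_def)
    show "integrable (empirical_measure X k n \<omega>) (\<lambda>x. exp (l * x))" for l
      unfolding empirical_measure_def
      by (subst integrable_distr_eq[OF block_average_measurable])
        (auto simp: uniform_count_measure_def integrable_point_measure_finite)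
  qed auto
qed

lemma empirical_log_mgf_eq_cgf:
  "empirical_log_mgf X k n \<omega> l = cgf (empirical_measure X k n \<omega>) (\<lambda>x. x) (real n * l) / real n"
  by (simp add: empirical_log_mgf_def cgf_def)

lemma convex_on_empirical_log_mgf:
  assumes "k n \<ge> 1"
  shows "convex_on UNIV (empirical_log_mgf X k n \<omega>)"
proof -
  interpret E: exp_moments "empirical_measure X k n \<omega>" "\<lambda>x. x" UNIV
    using assms by (rule exp_moments_empirical_measure)
  show ?thesis
  proof (rule convex_onI)
    fix t a b :: real
    assume t: "0 < t" "t < 1"
    have "cgf (empirical_measure X k n \<omega>) (\<lambda>x. x) (real n * ((1 - t) *\<^sub>R a + t *\<^sub>R b)) \<le>
        (1 - t) * cgf (empirical_measure X k n \<omega>) (\<lambda>x. x) (real n * a) +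
        t * cgf (empirical_measure X k n \<omega>) (\<lambda>x. x) (real n * b)"
      using convex_onD[OF E.convex_on_cgf, of t "real n * a" "real n * b"] t
      by (simp add: algebra_simps)
    then have "cgf (empirical_measure X k n \<omega>) (\<lambda>x. x) (real n * ((1 - t) *\<^sub>R a + t *\<^sub>R b)) / real n \<le>
        ((1 - t) * cgf (empirical_measure X k n \<omega>) (\<lambda>x. x) (real n * a) +
        t * cgf (empirical_measure X k n \<omega>) (\<lambda>x. x) (real n * b)) / real n"
      by (intro divide_right_mono) auto
    then show "empirical_log_mgf X k n \<omega> ((1 - t) *\<^sub>R a + t *\<^sub>R b) \<le>
        (1 - t) * empirical_log_mgf X k n \<omega> a + t * empirical_log_mgf X k n \<omega> b"
      by (simp add: empirical_log_mgf_eq_cgf add_divide_distrib)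
  qed auto
qed

text \<open>The exceptional null set is the same for all \<open>l\<close>: the region is open because the rate is continuous,
so countably many rational points suffice. The bound \<open>c\<close> may equal the lower limit,
which is what the critical regime uses, and may be infinite.\<close>

lemma (in iid_exp_moments) AE_empirical_log_mgf_tendsto:
  assumes k: "\<And>n. n \<ge> 1 \<Longrightarrow> k n \<ge> 1"
    and c: "c \<le> liminf (\<lambda>n. ereal (ln (real (k n)) / real n))"
  shows "AE \<omega> in M. \<forall>l\<in>J. ereal (tilted_rate M (X 1) l) < c \<longrightarrow>
    (\<lambda>n. empirical_log_mgf X k n \<omega> l) \<longlonglongrightarrow> G l"
proof -
  define V where "V = {l \<in> J. ereal (tilted_rate M (X 1) l) < c}"
  have "open V"
  proof -
    have "V = J \<inter> (\<lambda>l. ereal (tilted_rate M (X 1) l)) -` {..<c}"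
      by (auto simp: V_def)
    then show ?thesis
      using open_J continuous_on_tilted_rate
      by (auto intro!: continuous_open_preimage continuous_intros)
  qed
  have "AE \<omega> in M. \<forall>q\<in>V \<inter> \<rat>. (\<lambda>n. empirical_log_mgf X k n \<omega> q) \<longlonglongrightarrow> G q"
  proof (rule AE_ball_countable')
    show "countable (V \<inter> \<rat>)"
      using countable_rat by blast
    fix q
    assume "q \<in> V \<inter> \<rat>"
    then have q: "q \<in> J" "ereal (tilted_rate M (X 1) q) < c"
      by (auto simp: V_def)
    then obtain b where b: "tilted_rate M (X 1) q < b" "ereal b < c"
      using ereal_dense2[OF q(2)] by (metis ereal_dense3 less_ereal.simps(1))
    have ev: "\<forall>\<^sub>F n in sequentially. b \<le> ln (real (k n)) / real n"
      using less_LiminfD[OF less_le_trans[OF b(2) c]] by eventually_elim simp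
    have "AE \<omega> in M. \<forall>m::nat. (\<forall>\<^sub>F n in sequentially. empirical_log_mgf X k n \<omega> q < G q + inverse (Suc m)) \<and>
        (\<forall>\<^sub>F n in sequentially. G q - inverse (Suc m) < empirical_log_mgf X k n \<omega> q)"
      using AE_empirical_log_mgf_upper[OF k q(1)] AE_empirical_log_mgf_lower[OF k q(1) b(1) ev]
      by (subst AE_all_countable) (auto intro!: AE_conjI)
    then show "AE \<omega> in M. (\<lambda>n. empirical_log_mgf X k n \<omega> q) \<longlonglongrightarrow> G q"
    proof eventually_elim
      case (elim \<omega>)
      show ?case
      proof (rule tendstoI)
        fix e :: real
        assume "e > 0"
        then obtain m :: nat where m: "inverse (Suc m) < e"
          using reals_Archimedean by blast
        from elim have "\<forall>\<^sub>F n in sequentially. empirical_log_mgf X k n \<omega> q < G q + inverse (Suc m)"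
          and "\<forall>\<^sub>F n in sequentially. G q - inverse (Suc m) < empirical_log_mgf X k n \<omega> q"
          by blast+
        then show "\<forall>\<^sub>F n in sequentially. dist (empirical_log_mgf X k n \<omega> q) (G q) < e"
          by eventually_elim (use m in \<open>auto simp: dist_real_def abs_less_iff\<close>)
      qed
    qed
  qed
  then show ?thesis
  proof eventually_elim
    case (elim \<omega>)
    have conv: "\<forall>\<^sub>F n in sequentially. convex_on UNIV (empirical_log_mgf X k n \<omega>)"
      using eventually_ge_at_top[of 1] by eventually_elim (intro convex_on_empirical_log_mgf k)
    have "(\<lambda>n. empirical_log_mgf X k n \<omega> l) \<longlonglongrightarrow> G l" if "l \<in> V" for l
    proof (rule convex_pointwise_limit_of_rationals[OF conv \<open>open V\<close> _ that])
      show "continuous_on V G"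
        by (rule continuous_on_subset[OF continuous_on_cgf]) (auto simp: V_def)
    qed (use elim in blast)
    then show ?case
      by (auto simp: V_def)
  qed
qed

section \<open>Large deviations from convergence of cumulant generating functions\<close>

context exp_moments
begin

text \<open>Exponential Chebyshev inequality.\<close>

lemma measure_le_exp_cgf:
  assumes l: "l \<in> J" and A: "\<And>\<omega>. \<omega> \<in> space M \<Longrightarrow> \<omega> \<in> A \<Longrightarrow> a \<le> l * Y \<omega>"
  shows "measure M A \<le> exp (cgf M Y l - a)"
proof (cases "A \<in> sets M")
  case True
  have "measure M A = (\<integral>\<omega>. indicator A \<omega> \<partial>M)"
    using True by simp
  also have "\<dots> \<le> (\<integral>\<omega>. exp (- a) * exp (l * Y \<omega>) \<partial>M)"
  proof (rule integral_mono)
    show "integrable M (\<lambda>\<omega>. exp (- a) * exp (l * Y \<omega>))"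
      by (intro integrable_mult_right integrable_exp l)
    show "indicator A \<omega> \<le> exp (- a) * exp (l * Y \<omega>)" if "\<omega> \<in> space M" for \<omega>
      using A[OF that] by (auto simp: indicator_def exp_add[symmetric])
  qed (use True in \<open>auto simp: emeasure_eq_measure\<close>)
  also have "\<dots> = exp (cgf M Y l - a)"
    using integrable_exp[OF l] by (simp add: exp_cgf exp_diff exp_minus divide_inverse mult.commute)
  finally show ?thesis .
qed (simp add: measure_notin_sets)

text \<open>Splits \<open>exp (l * Y)\<close> according to whether \<open>Y\<close> is inside the interval, above it or below it, and pays
for each tail with a shift of \<open>l\<close> by \<open>h\<close> away from the interval.\<close>

lemma exp_cgf_le_interval_plus_tails:
  assumes "l \<in> J" "l + h \<in> J" "l - h \<in> J" "0 < h"
  shows "exp (cgf M Y l) \<le> exp (l * x + \<bar>l\<bar> * \<epsilon>) * prob {\<omega> \<in> space M. Y \<omega> \<in> {x - \<epsilon>..x + \<epsilon>}}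
    + exp (cgf M Y (l + h) - h * (x + \<epsilon>)) + exp (cgf M Y (l - h) + h * (x - \<epsilon>))"
proof -
  let ?A = "{\<omega> \<in> space M. Y \<omega> \<in> {x - \<epsilon>..x + \<epsilon>}}"
  have int: "integrable M (\<lambda>\<omega>. exp (l * x + \<bar>l\<bar> * \<epsilon>) * indicator ?A \<omega>)"
    "integrable M (\<lambda>\<omega>. exp (- h * (x + \<epsilon>)) * exp ((l + h) * Y \<omega>))"
    "integrable M (\<lambda>\<omega>. exp (h * (x - \<epsilon>)) * exp ((l - h) * Y \<omega>))"
    using assms by (auto intro!: integrable_mult_right integrable_exp simp: emeasure_eq_measure)
  have "exp (cgf M Y l) = (\<integral>\<omega>. exp (l * Y \<omega>) \<partial>M)"
    by (intro exp_cgf integrable_exp assms)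
  also have "\<dots> \<le> (\<integral>\<omega>. exp (l * x + \<bar>l\<bar> * \<epsilon>) * indicator ?A \<omega> +
      exp (- h * (x + \<epsilon>)) * exp ((l + h) * Y \<omega>) + exp (h * (x - \<epsilon>)) * exp ((l - h) * Y \<omega>) \<partial>M)"
  proof (rule integral_mono)
    fix \<omega>
    assume \<omega>: "\<omega> \<in> space M"
    let ?B = "exp (- h * (x + \<epsilon>)) * exp ((l + h) * Y \<omega>)" and ?C = "exp (h * (x - \<epsilon>)) * exp ((l - h) * Y \<omega>)"
    have pos: "0 \<le> exp (l * x + \<bar>l\<bar> * \<epsilon>) * indicator ?A \<omega>" "0 \<le> ?B" "0 \<le> ?C"
      by auto
    consider "\<omega> \<in> ?A" | "x + \<epsilon> < Y \<omega>" | "Y \<omega> < x - \<epsilon>"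
      using \<omega> by (cases "x + \<epsilon> < Y \<omega>"; cases "Y \<omega> < x - \<epsilon>") auto
    then show "exp (l * Y \<omega>) \<le> exp (l * x + \<bar>l\<bar> * \<epsilon>) * indicator ?A \<omega> + ?B + ?C"
    proof cases
      case 1
      then have "\<bar>l * (Y \<omega> - x)\<bar> \<le> \<bar>l\<bar> * \<epsilon>"
        unfolding abs_mult by (intro mult_left_mono) (auto simp: abs_le_iff)
      then have "exp (l * Y \<omega>) \<le> exp (l * x + \<bar>l\<bar> * \<epsilon>) * indicator ?A \<omega>"
        using 1 by (simp add: abs_le_iff algebra_simps)
      then show ?thesis
        using pos by linarith
    next
      case 2
      then have "0 \<le> h * (Y \<omega> - (x + \<epsilon>))"
        using assms by simp
      then have "exp (l * Y \<omega>) \<le> ?B"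
        by (simp add: exp_add[symmetric] algebra_simps)
      then show ?thesis
        using pos by linarith
    next
      case 3
      then have "0 \<le> h * ((x - \<epsilon>) - Y \<omega>)"
        using assms by simp
      then have "exp (l * Y \<omega>) \<le> ?C"
        by (simp add: exp_add[symmetric] algebra_simps)
      then show ?thesis
        using pos by linarith
    qed
  qed (use int integrable_exp[OF assms(1)] in auto)
  also have "\<dots> = exp (l * x + \<bar>l\<bar> * \<epsilon>) * prob ?A + exp (- h * (x + \<epsilon>)) * exp (cgf M Y (l + h)) +
      exp (h * (x - \<epsilon>)) * exp (cgf M Y (l - h))"
    using int assms by (simp add: exp_cgf integrable_exp)
  finally show ?thesis
    by (simp add: exp_add[symmetric] add.commute)
qed

end

lemma eventually_const_le_mult:
  fixes a b :: real
  assumes "0 < b"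
  shows "\<forall>\<^sub>F n in sequentially. a \<le> real n * b"
proof -
  have "\<forall>\<^sub>F n in sequentially. a / b \<le> real n"
    using filterlim_real_sequentially by (auto simp: filterlim_at_top)
  then show ?thesis
    using assms by (simp add: pos_divide_le_eq)
qed

text \<open>The lower bound of Gaertner and Ellis. As \<open>x\<close> is the slope of \<open>g\<close> at \<open>l\<close>, a small shift \<open>h\<close> to either
side makes both tails in \<open>exp_cgf_le_interval_plus_tails\<close> exponentially smaller than the total
mass \<open>exp (n g(l))\<close> of the tilted measure, which therefore concentrates on the interval.\<close>

lemma eventually_interval_measure_lower:
  fixes \<mu> :: "nat \<Rightarrow> real measure"
  defines "F \<equiv> \<lambda>n l. cgf (\<mu> n) (\<lambda>x. x) (real n * l) / real n"
  assumes \<mu>: "\<And>n. n \<ge> 1 \<Longrightarrow> exp_moments (\<mu> n) (\<lambda>x. x) UNIV" "\<And>n. n \<ge> 1 \<Longrightarrow> space (\<mu> n) = UNIV"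
    and V: "open V" "l \<in> V" and lim: "\<And>m. m \<in> V \<Longrightarrow> (\<lambda>n. F n m) \<longlonglongrightarrow> g m"
    and g: "(g has_real_derivative x) (at l)"
    and pos: "0 < \<epsilon>" "0 < \<delta>"
  shows "\<forall>\<^sub>F n in sequentially.
    exp (- (real n * (l * x - g l + \<bar>l\<bar> * \<epsilon> + \<delta>))) \<le> measure (\<mu> n) {x - \<epsilon>..x + \<epsilon>}"
proof -
  have d1: "((\<lambda>y. g y - (x + \<epsilon>) * y) has_real_derivative - \<epsilon>) (at l)"
    and d2: "((\<lambda>y. g y - (x - \<epsilon>) * y) has_real_derivative \<epsilon>) (at l)"
    using g by (auto intro!: derivative_eq_intros)
  obtain h1 where h1: "h1 > 0" "\<And>h. 0 < h \<Longrightarrow> h < h1 \<Longrightarrow>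
      g (l + h) - (x + \<epsilon>) * (l + h) < g l - (x + \<epsilon>) * l"
    using DERIV_neg_dec_right[OF d1] pos by auto
  obtain h2 where h2: "h2 > 0" "\<And>h. 0 < h \<Longrightarrow> h < h2 \<Longrightarrow>
      g (l - h) - (x - \<epsilon>) * (l - h) < g l - (x - \<epsilon>) * l"
    using DERIV_pos_inc_left[OF d2] pos by auto
  obtain \<rho> where \<rho>: "\<rho> > 0" "ball l \<rho> \<subseteq> V"
    using V open_contains_ball by blast
  define h where "h = min (min h1 h2) \<rho> / 2"
  have h: "0 < h" "h < h1" "h < h2" "h < \<rho>"
    using h1 h2 \<rho> by (auto simp: h_def)
  have hV: "l + h \<in> V" "l - h \<in> V"
    using h \<rho> by (auto simp: dist_real_def intro!: subsetD[OF \<rho>(2)])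
  define \<eta> where "\<eta> = min (g l - (g (l + h) - h * (x + \<epsilon>))) (g l - (g (l - h) + h * (x - \<epsilon>)))"
  have "\<eta> > 0"
    using h1(2)[OF h(1,2)] h2(2)[OF h(1,3)] by (simp add: \<eta>_def algebra_simps)
  have \<eta>_le: "\<eta> \<le> g l - (g (l + h) - h * (x + \<epsilon>))" "\<eta> \<le> g l - (g (l - h) + h * (x - \<epsilon>))"
    by (simp_all add: \<eta>_def)
  have close: "\<forall>\<^sub>F n in sequentially. \<bar>F n m - g m\<bar> < e" if "m \<in> V" "e > 0" for m e
    using tendstoD[OF lim, of m e] that by (simp add: dist_real_def)
  have ev: "\<forall>\<^sub>F n in sequentially. \<bar>F n (l + h) - g (l + h)\<bar> < \<eta> / 4"
    "\<forall>\<^sub>F n in sequentially. \<bar>F n (l - h) - g (l - h)\<bar> < \<eta> / 4"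
    "\<forall>\<^sub>F n in sequentially. \<bar>F n l - g l\<bar> < min (\<eta> / 4) (\<delta> / 2)"
    using \<open>\<eta> > 0\<close> pos hV V by (intro close; simp)+
  have "\<forall>\<^sub>F n in sequentially. ln 4 \<le> real n * (\<eta> / 2)"
    "\<forall>\<^sub>F n in sequentially. ln 2 \<le> real n * (\<delta> / 2)"
    using \<open>\<eta> > 0\<close> pos by (auto intro!: eventually_const_le_mult simp del: times_divide_eq_right)
  with ev eventually_ge_at_top[of 1] show ?thesis
  proof eventually_elim
    case (elim n)
    interpret E: exp_moments "\<mu> n" "\<lambda>x. x" UNIV
      using elim by (intro \<mu>)
    let ?p = "measure (\<mu> n) {x - \<epsilon>..x + \<epsilon>}"
    have F: "cgf (\<mu> n) (\<lambda>x. x) (real n * m) = real n * F n m" for m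
      using elim by (simp add: F_def)
    have tail: "exp (real n * u) \<le> exp (real n * F n l) / 4" if "u \<le> F n l - \<eta> / 2" for u
    proof -
      have "real n * u \<le> real n * (F n l - \<eta> / 2)"
        using that by (intro mult_left_mono) auto
      also have "\<dots> \<le> real n * F n l - ln 4"
        using elim by (simp add: algebra_simps)
      finally have "exp (real n * u) \<le> exp (real n * F n l - ln 4)"
        by simp
      then show ?thesis
        by (simp add: exp_diff)
    qed
    have "{\<omega> \<in> space (\<mu> n). \<omega> \<in> {x - \<epsilon>..x + \<epsilon>}} = {x - \<epsilon>..x + \<epsilon>}"
      using elim \<mu>(2)[of n] by auto
    then have "exp (real n * F n l) \<le> exp (real n * (l * x + \<bar>l\<bar> * \<epsilon>)) * ?p
        + exp (real n * (F n (l + h) - h * (x + \<epsilon>))) + exp (real n * (F n (l - h) + h * (x - \<epsilon>)))"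
      using E.exp_cgf_le_interval_plus_tails[of "real n * l" "real n * h" x \<epsilon>] h elim
      by (simp add: F abs_mult distrib_left[symmetric] right_diff_distrib[symmetric] mult.assoc)
    also have "\<dots> \<le> exp (real n * (l * x + \<bar>l\<bar> * \<epsilon>)) * ?p
        + exp (real n * F n l) / 4 + exp (real n * F n l) / 4"
    proof (intro add_mono tail order_refl)
      have *: "F n (l + h) < g (l + h) + \<eta> / 4" "F n (l - h) < g (l - h) + \<eta> / 4" "g l - \<eta> / 4 < F n l"
        using elim by linarith+
      show "F n (l + h) - h * (x + \<epsilon>) \<le> F n l - \<eta> / 2"
        using * \<eta>_le by linarith
      show "F n (l - h) + h * (x - \<epsilon>) \<le> F n l - \<eta> / 2"
        using * \<eta>_le by linarith
    qed
    finally have "exp (real n * F n l) / 2 \<le> exp (real n * (l * x + \<bar>l\<bar> * \<epsilon>)) * ?p"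
      by simp
    then have *: "exp (real n * F n l - ln 2 - real n * (l * x + \<bar>l\<bar> * \<epsilon>)) \<le> ?p"
    proof -
      have "exp (real n * F n l - ln 2 - real n * (l * x + \<bar>l\<bar> * \<epsilon>)) =
          exp (real n * F n l) / 2 / exp (real n * (l * x + \<bar>l\<bar> * \<epsilon>))"
        by (simp only: exp_diff exp_ln)
      with \<open>exp (real n * F n l) / 2 \<le> _\<close> show ?thesis
        by (simp only: pos_divide_le_eq exp_gt_zero mult.commute)
    qed
    have "g l - \<delta> / 2 \<le> F n l"
      using elim by linarith
    then have "real n * (g l - \<delta> / 2) \<le> real n * F n l"
      by (intro mult_left_mono) auto
    then have "- (real n * (l * x - g l + \<bar>l\<bar> * \<epsilon> + \<delta>)) \<le> real n * F n l - ln 2 - real n * (l * x + \<bar>l\<bar> * \<epsilon>)"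
      using elim by (simp add: algebra_simps)
    then show ?case
      using * by (meson exp_le_cancel_iff order_trans)
  qed
qed

context exp_moments
begin

text \<open>The smallest rate at those points of the open interval of radius \<open>\<epsilon>\<close> about the tilted mean at \<open>l\<close>
that are tilted means for a parameter between 0 and \<open>l\<close>. These parameters suffice, because away
from the mean the rate grows. The strict inequality leaves room for a small interval about each such
point; by continuity the infimum is the same as for the closed interval.\<close>

definition ray_interval_rate :: "real \<Rightarrow> real \<Rightarrow> real" where
  "ray_interval_rate l \<epsilon> = Inf ((\<lambda>s. tilted_rate M Y (s * l)) `
     {s \<in> {0..1}. \<bar>tilted_mean M Y (s * l) - tilted_mean M Y l\<bar> < \<epsilon>})"

context
  fixes l :: real
  assumes ray: "\<And>s. s \<in> {0..1} \<Longrightarrow> s * l \<in> J"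
begin

abbreviation "ray_mean s \<equiv> tilted_mean M Y (s * l)"
abbreviation "ray_rate s \<equiv> tilted_rate M Y (s * l)"
abbreviation "ray_near \<epsilon> \<equiv> {s \<in> {0..1}. \<bar>ray_mean s - ray_mean 1\<bar> < \<epsilon>}"

lemma ray_rate_nonneg: "s \<in> {0..1} \<Longrightarrow> 0 \<le> ray_rate s"
  using tilted_rate_ray_mono(1)[of 0 l s] ray[of 0] ray[of s] by simp

lemma bdd_below_ray_rate: "bdd_below (ray_rate ` ray_near \<epsilon>)"
  by (rule bdd_belowI2[of _ 0]) (auto intro!: ray_rate_nonneg)

lemma continuous_on_ray: "continuous_on {0..1} ray_mean" "continuous_on {0..1} ray_rate"
  using ray by (auto intro!: continuous_on_compose2[OF continuous_on_tilted_mean]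
      continuous_on_compose2[OF continuous_on_tilted_rate] continuous_intros)

lemma ray_interval_rate_le:
  "s \<in> ray_near \<epsilon> \<Longrightarrow> ray_interval_rate l \<epsilon> \<le> ray_rate s"
  unfolding ray_interval_rate_def using bdd_below_ray_rate[of \<epsilon>]
  by (intro cInf_lower) auto

lemma ex_ray_rate_less:
  assumes "0 < \<epsilon>" "ray_interval_rate l \<epsilon> < a"
  obtains s where "s \<in> ray_near \<epsilon>" "ray_rate s < a"
proof -
  have "1 \<in> ray_near \<epsilon>"
    using assms by simp
  then show ?thesis
    using assms that bdd_below_ray_rate[of \<epsilon>] unfolding ray_interval_rate_def
    by (subst (asm) cInf_less_iff) auto
qed

text \<open>The witness is the least parameter \<open>s\<close> in the closure of the admissible ones: it is either 0, where
the rate vanishes, or its tilted mean has reached the end of the interval facing the mean of \<open>Y\<close>.\<close>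

lemma ray_interval_rate_attained:
  assumes "0 < \<epsilon>"
  obtains s where "s \<in> {0..1}" "ray_interval_rate l \<epsilon> \<le> ray_rate s"
    "s = 0 \<or> \<epsilon> \<le> \<bar>ray_mean s - ray_mean 1\<bar>"
proof -
  define s where "s = Inf (ray_near \<epsilon>)"
  have one: "1 \<in> ray_near \<epsilon>"
    using assms by simp
  have bdd: "bdd_below (ray_near \<epsilon>)"
    by (rule bdd_belowI[of _ 0]) auto
  have sub: "closure (ray_near \<epsilon>) \<subseteq> {0..1}"
    by (rule closure_minimal) auto
  have scl: "s \<in> closure (ray_near \<epsilon>)"
    unfolding s_def using one bdd by (intro closure_contains_Inf) blast
  then have s: "s \<in> {0..1}"
    using sub by blast
  have "ray_interval_rate l \<epsilon> \<le> ray_rate s"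
    by (rule continuous_ge_on_closure[OF continuous_on_subset[OF continuous_on_ray(2) sub] scl])
      (rule ray_interval_rate_le)
  moreover have "\<epsilon> \<le> \<bar>ray_mean s - ray_mean 1\<bar>" if "s \<noteq> 0"
  proof -
    have "s > 0"
      using s that by simp
    have cl: "closure {0..<s} = {0..s}"
      using \<open>s > 0\<close> by (rule closure_atLeastLessThan)
    have "continuous_on (closure {0..<s}) (\<lambda>s. \<bar>ray_mean s - ray_mean 1\<bar>)"
      unfolding cl using s
      by (intro continuous_intros continuous_on_subset[OF continuous_on_ray(1)]) auto
    moreover have "s \<in> closure {0..<s}"
      unfolding cl using s by simp
    moreover have "\<epsilon> \<le> \<bar>ray_mean t - ray_mean 1\<bar>" if t: "t \<in> {0..<s}" for t
    proof (rule ccontr)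
      assume "\<not> ?thesis"
      then have "t \<in> ray_near \<epsilon>"
        using t s by auto
      then have "s \<le> t"
        unfolding s_def by (intro cInf_lower bdd)
      then show False
        using t by simp
    qed
    ultimately show ?thesis
      by (rule continuous_ge_on_closure)
  qed
  ultimately show ?thesis
    using s that by blast
qed

text \<open>A point \<open>y\<close> at distance less than \<open>\<epsilon>\<close> from \<open>tilted_mean M Y l\<close> has rate at least \<open>l y - cgf M Y l\<close>,
by the definition of the Legendre transform.\<close>

lemma ray_interval_rate_bounds:
  assumes "0 < \<epsilon>"
  shows "tilted_rate M Y l - \<bar>l\<bar> * \<epsilon> \<le> ray_interval_rate l \<epsilon>"
    and "ray_interval_rate l \<epsilon> \<le> tilted_rate M Y l"
proof -
  have one: "1 \<in> ray_near \<epsilon>"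
    using assms by simp
  show "ray_interval_rate l \<epsilon> \<le> tilted_rate M Y l"
    using ray_interval_rate_le[OF one] by simp
  have "tilted_rate M Y l - \<bar>l\<bar> * \<epsilon> \<le> ray_rate s" if s: "s \<in> ray_near \<epsilon>" for s
  proof -
    have "l * ray_mean s - cgf M Y l \<le> ray_rate s"
      using cgf_above_tangent[OF ray[of s] integrable_exp[OF ray[of 1]]] s
      by (simp add: tilted_rate_def algebra_simps)
    moreover have "\<bar>l * (ray_mean s - ray_mean 1)\<bar> \<le> \<bar>l\<bar> * \<epsilon>"
      unfolding abs_mult using s by (intro mult_left_mono) auto
    ultimately show ?thesis
      by (simp add: tilted_rate_def abs_le_iff algebra_simps)
  qed
  then show "tilted_rate M Y l - \<bar>l\<bar> * \<epsilon> \<le> ray_interval_rate l \<epsilon>"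
    unfolding ray_interval_rate_def using one by (intro cInf_greatest) auto
qed

lemma ray_interval_rate_tendsto: "((\<lambda>\<epsilon>. ray_interval_rate l \<epsilon>) \<longlongrightarrow> tilted_rate M Y l) (at_right 0)"
proof (rule tendsto_sandwich)
  show "\<forall>\<^sub>F \<epsilon> in at_right 0. tilted_rate M Y l - \<bar>l\<bar> * \<epsilon> \<le> ray_interval_rate l \<epsilon>"
    "\<forall>\<^sub>F \<epsilon> in at_right 0. ray_interval_rate l \<epsilon> \<le> tilted_rate M Y l"
    using eventually_at_right_less[of 0]
    by (auto elim!: eventually_mono intro: ray_interval_rate_bounds)
  have "((\<lambda>\<epsilon>. tilted_rate M Y l - \<bar>l\<bar> * \<epsilon>) \<longlongrightarrow> tilted_rate M Y l - \<bar>l\<bar> * 0) (at_right 0)"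
    by (intro tendsto_intros)
  then show "((\<lambda>\<epsilon>. tilted_rate M Y l - \<bar>l\<bar> * \<epsilon>) \<longlongrightarrow> tilted_rate M Y l) (at_right 0)"
    by simp
qed simp

text \<open>Lower bound: apply \<open>eventually_interval_measure_lower\<close> near an almost optimal point of the interval.
Upper bound: the parameter \<open>s\<close> from \<open>ray_interval_rate_attained\<close> is 0, where the bound is
trivial, or has its tilted mean at or beyond the end of the interval facing the mean; so the Chebyshev
inequality with \<open>s * l\<close> covers the whole interval.\<close>

lemma interval_measure_rate:
  fixes \<mu> :: "nat \<Rightarrow> real measure"
  defines "F \<equiv> \<lambda>n l. cgf (\<mu> n) (\<lambda>x. x) (real n * l) / real n"
  assumes \<mu>: "\<And>n. n \<ge> 1 \<Longrightarrow> exp_moments (\<mu> n) (\<lambda>x. x) UNIV" "\<And>n. n \<ge> 1 \<Longrightarrow> sets (\<mu> n) = sets borel"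
    and V: "open V" "V \<subseteq> J" "\<And>s. s \<in> {0..1} \<Longrightarrow> s * l \<in> V"
    and lim: "\<And>m. m \<in> V \<Longrightarrow> (\<lambda>n. F n m) \<longlonglongrightarrow> cgf M Y m"
    and \<epsilon>: "0 < \<epsilon>"
  defines "I \<equiv> {tilted_mean M Y l - \<epsilon>..tilted_mean M Y l + \<epsilon>}"
  shows "\<forall>\<^sub>F n in sequentially. 0 < measure (\<mu> n) I"
    and "(\<lambda>n. 1 / real n * ln (measure (\<mu> n) I)) \<longlonglongrightarrow> - ray_interval_rate l \<epsilon>"
proof -
  let ?R = "ray_interval_rate l \<epsilon>"
  have space: "space (\<mu> n) = UNIV" if "n \<ge> 1" for n
    using sets_eq_imp_space_eq[OF \<mu>(2)[OF that]] by simp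
  have lower: "\<forall>\<^sub>F n in sequentially. exp (- (real n * (?R + \<delta>))) \<le> measure (\<mu> n) I" if "\<delta> > 0" for \<delta>
  proof -
    obtain s where s: "s \<in> ray_near \<epsilon>" "ray_rate s < ?R + \<delta> / 3"
      using ex_ray_rate_less[OF \<epsilon>, of "?R + \<delta> / 3"] \<open>\<delta> > 0\<close> by auto
    \<comment> \<open>Small enough for the interval of radius \<open>e\<close> about \<open>ray_mean s\<close> to lie in \<open>I\<close>, and for the loss
      \<open>\<bar>s * l\<bar> * e\<close> in the exponent to be at most \<open>\<delta> / 3\<close>.\<close>
    define e where "e = min (\<epsilon> - \<bar>ray_mean s - ray_mean 1\<bar>) (\<delta> / 3 / (\<bar>s * l\<bar> + 1))"
    have "0 < e"
      using s \<open>\<delta> > 0\<close> by (auto simp: e_def add_nonneg_pos)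
    have "\<bar>s * l\<bar> * e \<le> (\<bar>s * l\<bar> + 1) * e"
      using \<open>0 < e\<close> by (intro mult_right_mono) auto
    also have "\<dots> \<le> (\<bar>s * l\<bar> + 1) * (\<delta> / 3 / (\<bar>s * l\<bar> + 1))"
      by (intro mult_left_mono) (auto simp: e_def)
    also have "\<dots> = \<delta> / 3"
    proof -
      have "\<bar>s * l\<bar> + 1 \<noteq> 0"
        by linarith
      then show ?thesis
        by (metis nonzero_mult_div_cancel_left times_divide_eq_right)
    qed
    finally have e: "\<bar>s * l\<bar> * e \<le> \<delta> / 3" .
    have "s * l \<in> V"
      using s V by auto
    have sub: "{ray_mean s - e..ray_mean s + e} \<subseteq> I"
    proof -
      have "\<bar>ray_mean s - ray_mean 1\<bar> + e \<le> \<epsilon>"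
        by (simp add: e_def)
      then show ?thesis
        unfolding I_def by auto
    qed
    have "\<forall>\<^sub>F n in sequentially. exp (- (real n * (s * l * ray_mean s - cgf M Y (s * l) + \<bar>s * l\<bar> * e + \<delta> / 3)))
        \<le> measure (\<mu> n) {ray_mean s - e..ray_mean s + e}"
    proof (rule eventually_interval_measure_lower[OF \<mu>(1) space V(1) \<open>s * l \<in> V\<close>])
      show "(\<lambda>n. cgf (\<mu> n) (\<lambda>x. x) (real n * m) / real n) \<longlonglongrightarrow> cgf M Y m" if "m \<in> V" for m
        using lim[OF that] by (simp add: F_def)
      show "(cgf M Y has_real_derivative ray_mean s) (at (s * l))"
        using \<open>s * l \<in> V\<close> V by (intro DERIV_cgf) auto
    qed (use \<open>0 < e\<close> \<open>\<delta> > 0\<close> in auto)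
    with eventually_ge_at_top[of 1] show ?thesis
    proof eventually_elim
      case (elim n)
      interpret E: exp_moments "\<mu> n" "\<lambda>x. x" UNIV
        using elim by (intro \<mu>)
      have "real n * (s * l * ray_mean s - cgf M Y (s * l) + \<bar>s * l\<bar> * e + \<delta> / 3) \<le> real n * (?R + \<delta>)"
        using s e by (intro mult_left_mono) (auto simp: tilted_rate_def)
      then have "exp (- (real n * (?R + \<delta>))) \<le>
          exp (- (real n * (s * l * ray_mean s - cgf M Y (s * l) + \<bar>s * l\<bar> * e + \<delta> / 3)))"
        by simp
      also have "\<dots> \<le> measure (\<mu> n) {ray_mean s - e..ray_mean s + e}"
        by (rule elim)
      also have "\<dots> \<le> measure (\<mu> n) I"
        using sub \<mu>(2) elim by (intro E.finite_measure_mono) (auto simp: I_def)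
      finally show ?case .
    qed
  qed
  have upper: "\<forall>\<^sub>F n in sequentially. measure (\<mu> n) I \<le> exp (- (real n * (?R - \<delta>)))" if "\<delta> > 0" for \<delta>
  proof -
    obtain s where s: "s \<in> {0..1}" "?R \<le> ray_rate s" "s = 0 \<or> \<epsilon> \<le> \<bar>ray_mean s - ray_mean 1\<bar>"
      using ray_interval_rate_attained[OF \<epsilon>] by blast
    \<comment> \<open>Since \<open>l\<close> and \<open>ray_mean 1 - ray_mean s\<close> have the same sign, this says that \<open>y\<close> lies on the side of
      \<open>ray_mean s\<close> to which the tilting by \<open>s * l\<close> points.\<close>
    have far: "s * l * ray_mean s \<le> s * l * y" if "y \<in> I" for y
    proof (cases "s = 0")
      case False
      have sl: "0 \<le> l * (ray_mean 1 - ray_mean s)"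
      proof (cases "s = 1")
        case False
        have "0 \<le> (1 - s) * (l * (ray_mean 1 - ray_mean s))"
          using tilted_mean_mono[OF ray[OF s(1)] ray[of 1]] by (simp add: algebra_simps)
        then show ?thesis
          using False s by (simp add: zero_le_mult_iff)
      qed simp
      have "\<bar>l * (ray_mean 1 - y)\<bar> \<le> \<bar>l\<bar> * \<epsilon>"
        unfolding abs_mult using \<open>y \<in> I\<close> by (intro mult_left_mono) (auto simp: I_def abs_le_iff)
      also have "\<dots> \<le> \<bar>l\<bar> * \<bar>ray_mean 1 - ray_mean s\<bar>"
        using s False by (intro mult_left_mono) (auto simp: abs_minus_commute)
      also have "\<dots> = l * (ray_mean 1 - ray_mean s)"
        using sl by (simp add: abs_mult[symmetric])
      finally have "l * ray_mean s \<le> l * y"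
        by (simp add: abs_le_iff algebra_simps)
      then show ?thesis
        using s mult_left_mono[of "l * ray_mean s" "l * y" s] by (simp add: mult.assoc)
    qed simp
    have "\<forall>\<^sub>F n in sequentially. F n (s * l) < cgf M Y (s * l) + \<delta>"
      using lim[OF V(3)[OF s(1)]] \<open>\<delta> > 0\<close> by (intro order_tendstoD) auto
    with eventually_ge_at_top[of 1] show ?thesis
    proof eventually_elim
      case (elim n)
      interpret E: exp_moments "\<mu> n" "\<lambda>x. x" UNIV
        using elim by (intro \<mu>)
      have "measure (\<mu> n) I \<le> exp (cgf (\<mu> n) (\<lambda>x. x) (real n * (s * l)) - real n * (s * l * ray_mean s))"
      proof (rule E.measure_le_exp_cgf)
        fix y
        assume "y \<in> I"
        then have "real n * (s * l * ray_mean s) \<le> real n * (s * l * y)"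
          by (intro mult_left_mono far) auto
        then show "real n * (s * l * ray_mean s) \<le> real n * (s * l) * y"
          by (simp add: mult.assoc)
      qed simp
      also have "cgf (\<mu> n) (\<lambda>x. x) (real n * (s * l)) = real n * F n (s * l)"
        using elim by (simp add: F_def)
      also have "exp (real n * F n (s * l) - real n * (s * l * ray_mean s)) \<le> exp (real n * (- (?R - \<delta>)))"
        unfolding right_diff_distrib[symmetric] using elim s
        by (intro iffD2[OF exp_le_cancel_iff] mult_left_mono) (auto simp: tilted_rate_def)
      finally show ?case
        by (simp only: mult_minus_right)
    qed
  qed
  show pos: "\<forall>\<^sub>F n in sequentially. 0 < measure (\<mu> n) I"
    using lower[of 1] by (auto elim!: eventually_mono intro: less_le_trans[OF exp_gt_zero])
  show "(\<lambda>n. 1 / real n * ln (measure (\<mu> n) I)) \<longlonglongrightarrow> - ?R"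
  proof (rule tendstoI)
    fix d :: real
    assume "d > 0"
    then have "\<forall>\<^sub>F n in sequentially. exp (- (real n * (?R + d / 2))) \<le> measure (\<mu> n) I"
      "\<forall>\<^sub>F n in sequentially. measure (\<mu> n) I \<le> exp (- (real n * (?R - d / 2)))"
      using lower[of "d / 2"] upper[of "d / 2"] by simp_all
    with eventually_ge_at_top[of 1] pos
    show "\<forall>\<^sub>F n in sequentially. dist (1 / real n * ln (measure (\<mu> n) I)) (- ?R) < d"
    proof eventually_elim
      case (elim n)
      have "real n * (- ?R - d / 2) \<le> ln (measure (\<mu> n) I)"
        using elim by (subst ln_ge_iff) (auto simp: algebra_simps)
      moreover have "ln (measure (\<mu> n) I) \<le> real n * (- ?R + d / 2)"
        using elim ln_le_cancel_iff[of "measure (\<mu> n) I" "exp (- (real n * (?R - d / 2)))"]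
        by (simp add: algebra_simps)
      ultimately have "- ?R - d / 2 \<le> ln (measure (\<mu> n) I) / real n" "ln (measure (\<mu> n) I) / real n \<le> - ?R + d / 2"
        using elim by (auto simp: pos_le_divide_eq pos_divide_le_eq mult.commute)
      then show ?case
        using \<open>d > 0\<close> by (simp add: dist_real_def abs_less_iff)
    qed
  qed
qed

end

end

section \<open>The critical growth rate\<close>

text \<open>A convex function lies above its secant through \<open>1 - 2 h\<close> and \<open>1 - h\<close> to the right of \<open>1 - h\<close>. As
\<open>h\<close> tends to 0, the secants of the limit \<open>g\<close> approach its tangent at 1.\<close>

lemma convex_past_critical_lower:
  fixes f :: "nat \<Rightarrow> real \<Rightarrow> real"
  assumes convex: "\<forall>\<^sub>F n in sequentially. convex_on UNIV (f n)"
    and lim: "\<And>s. 0 < s \<Longrightarrow> s < 1 \<Longrightarrow> (\<lambda>n. f n s) \<longlonglongrightarrow> g s"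
    and g: "(g has_real_derivative g1) (at 1)"
    and t: "1 \<le> t" and a: "a < g 1 + (t - 1) * g1"
  shows "\<forall>\<^sub>F n in sequentially. a < f n t"
proof -
  define \<phi> where "\<phi> h = g (1 - h) + (t - 1 + h) * ((g (1 - h) - g (1 - 2 * h)) / h)" for h
  have quot: "((\<lambda>h. (g (1 + c * h) - g 1) / h) \<longlongrightarrow> c * g1) (at_right 0)" for c
  proof -
    have "((\<lambda>h. 1 + c * h) has_real_derivative c) (at 0)"
      by (auto intro!: derivative_eq_intros)
    with g have "((\<lambda>h. g (1 + c * h)) has_real_derivative c * g1) (at 0)"
      using DERIV_chain2[of g g1 "\<lambda>h. 1 + c * h" 0] by (simp add: mult.commute[of g1])
    then show ?thesis
      unfolding DERIV_def by (auto intro: tendsto_within_subset)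
  qed
  have "((\<lambda>h. (g (1 + (- 1) * h) - g 1) / h - (g (1 + (- 2) * h) - g 1) / h) \<longlongrightarrow> (- 1) * g1 - (- 2) * g1) (at_right 0)"
    by (intro tendsto_diff quot)
  then have slope: "((\<lambda>h. (g (1 - h) - g (1 - 2 * h)) / h) \<longlongrightarrow> g1) (at_right 0)"
    by (simp add: diff_divide_distrib[symmetric])
  have "((\<lambda>h. g (1 - h)) \<longlongrightarrow> g (1 - 0)) (at_right 0)"
  proof (rule isCont_tendsto_compose[where g = g])
    show "((\<lambda>h. 1 - h) \<longlongrightarrow> 1 - 0) (at_right (0 :: real))"
      by (intro tendsto_intros)
  qed (use DERIV_isCont[OF g] in simp)
  with slope have "(\<phi> \<longlongrightarrow> g (1 - 0) + (t - 1 + 0) * g1) (at_right 0)"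
    unfolding \<phi>_def by (intro tendsto_intros)
  then have "\<forall>\<^sub>F h in at_right 0. a < \<phi> h"
    using a by (intro order_tendstoD) auto
  moreover have "\<forall>\<^sub>F h in at_right 0. 0 < h \<and> h < (1 / 2 :: real)"
    by (auto simp: eventually_at_right_field intro!: exI[of _ "1 / 2"])
  ultimately have "\<forall>\<^sub>F h in at_right 0. a < \<phi> h \<and> 0 < h \<and> h < 1 / 2"
    by eventually_elim simp
  then obtain h where h: "a < \<phi> h" "0 < h" "h < 1 / 2"
    using eventually_happens by fastforce
  have "(\<lambda>n. f n (1 - h) + (t - 1 + h) * ((f n (1 - h) - f n (1 - 2 * h)) / h)) \<longlonglongrightarrow> \<phi> h"
    unfolding \<phi>_def using h by (intro tendsto_intros lim) auto
  then have "\<forall>\<^sub>F n in sequentially. a < f n (1 - h) + (t - 1 + h) * ((f n (1 - h) - f n (1 - 2 * h)) / h)"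
    using h by (intro order_tendstoD)
  with convex show ?thesis
  proof eventually_elim
    case (elim n)
    \<comment> \<open>The weight of \<open>t\<close> in \<open>1 - h\<close> as a convex combination of \<open>1 - 2 * h\<close> and \<open>t\<close>.\<close>
    define u where "u = h / (t - 1 + 2 * h)"
    have u: "0 < u" "u \<le> 1" "u * (t - 1 + 2 * h) = h"
      using h t by (auto simp: u_def pos_divide_le_eq)
    have "1 - h = (1 - u) *\<^sub>R (1 - 2 * h) + u *\<^sub>R t"
      using u(3) by (simp add: algebra_simps)
    then have "f n (1 - h) \<le> (1 - u) * f n (1 - 2 * h) + u * f n t"
      using convex_onD[OF elim(1), of u "1 - 2 * h" t] u by simp
    then have "(t - 1 + 2 * h) * f n (1 - h) \<le> (t - 1 + 2 * h) * ((1 - u) * f n (1 - 2 * h) + u * f n t)"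
      using h t by (intro mult_left_mono) auto
    also have "\<dots> = (t - 1 + h) * f n (1 - 2 * h) + h * f n t"
    proof -
      have "(t - 1 + 2 * h) * ((1 - u) * p + u * q) =
          (t - 1 + 2 * h) * p - (u * (t - 1 + 2 * h)) * p + (u * (t - 1 + 2 * h)) * q" for p q
        by (simp add: algebra_simps)
      then have "(t - 1 + 2 * h) * ((1 - u) * p + u * q) = (t - 1 + 2 * h) * p - h * p + h * q" for p q
        unfolding u(3) .
      then have "(t - 1 + 2 * h) * ((1 - u) * p + u * q) = (t - 1 + h) * p + h * q" for p q
        by (simp only: left_diff_distrib distrib_right)
      then show ?thesis .
    qed
    finally have "h * (f n (1 - h) + (t - 1 + h) * ((f n (1 - h) - f n (1 - 2 * h)) / h)) \<le> h * f n t"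
      using h by (simp add: distrib_left) (simp add: algebra_simps)
    then show ?case
      using elim h by simp
  qed
qed

lemma sum_powr_le_powr_sum:
  fixes a :: "'i \<Rightarrow> real"
  assumes "finite I" "\<And>i. i \<in> I \<Longrightarrow> 0 \<le> a i" "1 \<le> t"
  shows "(\<Sum>i\<in>I. a i powr t) \<le> (\<Sum>i\<in>I. a i) powr t"
proof (cases "(\<Sum>i\<in>I. a i) = 0")
  case True
  then have "\<forall>i\<in>I. a i = 0"
    using assms by (simp add: sum_nonneg_eq_0_iff)
  then show ?thesis by simp
next
  case False
  define S where "S = (\<Sum>i\<in>I. a i)"
  have "S > 0"
    using False assms sum_nonneg[of I a] by (simp add: S_def less_le)
  have "a i powr t \<le> S powr (t - 1) * a i" if "i \<in> I" for i
  proof (cases "a i = 0")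
    case False
    then have "a i > 0"
      using assms(2)[OF that] by simp
    have "a i powr t = a i powr (t - 1) * a i"
      using \<open>a i > 0\<close> powr_add[of "a i" "t - 1" 1] by simp
    also have "\<dots> \<le> S powr (t - 1) * a i"
      using assms that \<open>a i > 0\<close> unfolding S_def
      by (intro mult_right_mono powr_mono2 member_le_sum) auto
    finally show ?thesis .
  qed simp
  then have "(\<Sum>i\<in>I. a i powr t) \<le> (\<Sum>i\<in>I. S powr (t - 1) * a i)"
    by (rule sum_mono)
  also have "\<dots> = S powr t"
    using \<open>S > 0\<close> powr_add[of S "t - 1" 1] by (simp add: S_def sum_distrib_left)
  finally show ?thesis
    by (simp add: S_def)
qed

text \<open>The sum of the powers is at most the power of the sum; passing to averages costs the factor
\<open>k(n)\<close> to the power \<open>t - 1\<close>.\<close>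

lemma empirical_log_mgf_scale_le:
  assumes n: "n \<ge> 1" "k n \<ge> 1" and t: "1 \<le> t"
  shows "empirical_log_mgf X k n \<omega> (t * l) \<le>
    (t - 1) * (ln (real (k n)) / real n) + t * empirical_log_mgf X k n \<omega> l"
proof -
  let ?S = "\<lambda>l. \<Sum>j=1..k n. exp (l * block_sum X n j \<omega>)"
  have pos: "0 < ?S l" for l
    using n by (intro sum_pos) auto
  have F: "empirical_log_mgf X k n \<omega> l = (ln (?S l) - ln (real (k n))) / real n" for l
    using n pos[of l] by (simp add: empirical_log_mgf_eq ln_div)
  have "exp (t * l * block_sum X n j \<omega>) = exp (l * block_sum X n j \<omega>) powr t" for j
    by (simp add: powr_def mult.assoc)
  then have "?S (t * l) \<le> ?S l powr t"
    using sum_powr_le_powr_sum[of "{1..k n}" "\<lambda>j. exp (l * block_sum X n j \<omega>)" t] t by simp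
  then have "ln (?S (t * l)) \<le> ln (?S l powr t)"
    using pos by (subst ln_le_cancel_iff) (auto simp: less_imp_neq[symmetric])
  also have "\<dots> = t * ln (?S l)"
    using pos[of l] by (simp add: ln_powr)
  finally have "(ln (?S (t * l)) - ln (real (k n))) / real n \<le> (t * ln (?S l) - ln (real (k n))) / real n"
    by (intro divide_right_mono) auto
  also have "\<dots> = (t - 1) * (ln (real (k n)) / real n) + t * ((ln (?S l) - ln (real (k n))) / real n)"
    using n by (simp add: field_simps)
  finally show ?thesis
    by (simp add: F)
qed

context iid_exp_moments
begin

lemma AE_empirical_log_mgf_constant:
  assumes "AE \<omega> in M. X 1 \<omega> = x"
  shows "AE \<omega> in M. \<forall>n\<ge>1. k n \<ge> 1 \<longrightarrow> (\<forall>l. empirical_log_mgf X k n \<omega> l = l * x)"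
proof -
  have "AE \<omega> in M. X i \<omega> = x" if "i \<ge> 1" for i
  proof -
    have "AE y in distr M borel (X 1). y = x"
      using assms by (subst AE_distr_iff) (auto intro: rv_X)
    then have "AE y in distr M borel (X i). y = x"
      by (simp only: ident[OF that])
    then show ?thesis
      by (subst (asm) AE_distr_iff) (auto intro: rv_X that)
  qed
  then have "AE \<omega> in M. \<forall>i. i \<ge> 1 \<longrightarrow> X i \<omega> = x"
    by (subst AE_all_countable) auto
  then show ?thesis
  proof eventually_elim
    case (elim \<omega>)
    show ?case
    proof (intro allI impI)
      fix n :: nat and l :: real
      assume n: "1 \<le> n" "1 \<le> k n"
      have "block_sum X n j \<omega> = real n * x" if "j \<ge> 1" for j
      proof -
        have "block_sum X n j \<omega> = (\<Sum>i\<in>{(j - 1) * n + 1..j * n}. x)"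
          unfolding block_sum_eq[OF that] using elim by (intro sum.cong) auto
        also have "\<dots> = real n * x"
          using that by (simp add: diff_mult_distrib)
        finally show ?thesis .
      qed
      then have "(\<Sum>j=1..k n. exp (l * block_sum X n j \<omega>)) = real (k n) * exp (l * (real n * x))"
        by simp
      then show "empirical_log_mgf X k n \<omega> l = l * x"
        using n by (simp add: empirical_log_mgf_eq)
    qed
  qed
qed

text \<open>With \<open>x\<close> the tilted mean at \<open>l\<close>, the upper bound \<open>(t - 1) (l x - G(l)) + t G(l)\<close> from
\<open>empirical_log_mgf_scale_le\<close> and the tangent \<open>G(l) + (t - 1) l x\<close> from convexity agree. For constant
\<open>X 1\<close> the rate does not increase strictly along the ray, so there the limit is computed directly.\<close>

lemma AE_empirical_log_mgf_critical:
  assumes k: "\<And>n. n \<ge> 1 \<Longrightarrow> k n \<ge> 1"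
    and ray: "\<And>s. s \<in> {0..1} \<Longrightarrow> s * l \<in> J"
    and crit: "(\<lambda>n. ln (real (k n)) / real n) \<longlonglongrightarrow> tilted_rate M (X 1) l"
  shows "AE \<omega> in M. \<forall>t\<ge>1. (\<lambda>n. empirical_log_mgf X k n \<omega> (t * l))
    \<longlonglongrightarrow> G l + (t - 1) * l * tilted_mean M (X 1) l"
proof -
  let ?x = "tilted_mean M (X 1) l"
  have l: "l \<in> J"
    using ray[of 1] by simp
  consider "l = 0" | "AE \<omega> in M. X 1 \<omega> = ?x" | "l \<noteq> 0" "\<not> (AE \<omega> in M. X 1 \<omega> = ?x)"
    by blast
  then show ?thesis
  proof cases
    case 1
    have "empirical_log_mgf X k n \<omega> 0 = 0" if "n \<ge> 1" for n \<omega>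
      using k[OF that] that by (simp add: empirical_log_mgf_eq)
    then have "(\<lambda>n. empirical_log_mgf X k n \<omega> 0) \<longlonglongrightarrow> 0" for \<omega>
      by (intro tendsto_eventually) (auto simp: eventually_sequentially)
    then show ?thesis
      using 1 by (simp del: One_nat_def)
  next
    case 2
    have "AE \<omega> in M. exp (l * X 1 \<omega>) = exp (l * ?x)"
      using 2 by eventually_elim simp
    then have "(\<integral>\<omega>. exp (l * X 1 \<omega>) \<partial>M) = (\<integral>\<omega>. exp (l * ?x) \<partial>M)"
      by (intro integral_cong_AE) measurable
    then have "G l = l * ?x"
      unfolding cgf_def by (simp add: prob_space)
    from AE_empirical_log_mgf_constant[OF 2, of k] show ?thesis
    proof eventually_elim
      case (elim \<omega>)
      have "\<forall>\<^sub>F n in sequentially. empirical_log_mgf X k n \<omega> (t * l) = t * l * ?x" for t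
        using eventually_ge_at_top[of 1] by eventually_elim (use elim k in blast)
      then have "(\<lambda>n. empirical_log_mgf X k n \<omega> (t * l)) \<longlonglongrightarrow> t * l * ?x" for t
        by (rule tendsto_eventually)
      moreover have "G l + (t - 1) * l * ?x = t * l * ?x" for t
        using \<open>G l = l * ?x\<close> by (simp add: algebra_simps)
      ultimately show ?case
        by metis
    qed
  next
    case 3
    have "liminf (\<lambda>n. ereal (ln (real (k n)) / real n)) = ereal (tilted_rate M (X 1) l)"
      using crit by (intro lim_imp_Liminf) auto
    then have below: "AE \<omega> in M. \<forall>m\<in>J. ereal (tilted_rate M (X 1) m) < ereal (tilted_rate M (X 1) l) \<longrightarrow>
        (\<lambda>n. empirical_log_mgf X k n \<omega> m) \<longlonglongrightarrow> G m"
      by (intro AE_empirical_log_mgf_tendsto k) auto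
    have "AE \<omega> in M. \<forall>m::nat. \<forall>\<^sub>F n in sequentially. empirical_log_mgf X k n \<omega> l < G l + inverse (Suc m)"
    proof (subst AE_all_countable, rule allI)
      show "AE \<omega> in M. \<forall>\<^sub>F n in sequentially. empirical_log_mgf X k n \<omega> l < G l + inverse (Suc m)" for m
        by (rule AE_empirical_log_mgf_upper[OF k l]) auto
    qed
    with below show ?thesis
    proof eventually_elim
      case (elim \<omega>)
      let ?F = "empirical_log_mgf X k"
      have ev: "\<forall>\<^sub>F n in sequentially. n \<ge> 1 \<and> k n \<ge> 1"
        using eventually_ge_at_top[of 1] by eventually_elim (use k in blast)
      have conv: "\<forall>\<^sub>F n in sequentially. convex_on UNIV (\<lambda>s. ?F n \<omega> (s * l))"
        using ev
      proof eventually_elim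
        case (elim n)
        then have *: "convex_on UNIV (?F n \<omega>)"
          by (intro convex_on_empirical_log_mgf) auto
        show ?case
        proof (rule convex_onI)
          fix u a b :: real
          assume "0 < u" "u < 1"
          then show "?F n \<omega> (((1 - u) *\<^sub>R a + u *\<^sub>R b) * l) \<le> (1 - u) * ?F n \<omega> (a * l) + u * ?F n \<omega> (b * l)"
            using convex_onD[OF *, of u "a * l" "b * l"] by (simp add: algebra_simps)
        qed auto
      qed
      have sub: "(\<lambda>n. ?F n \<omega> (s * l)) \<longlonglongrightarrow> G (s * l)" if "0 < s" "s < 1" for s
        using tilted_rate_ray_mono(2)[of s l 1] 3 that ray[of s] l elim(1) by auto
      have "(G has_real_derivative ?x) (at (1 * l))"
        using DERIV_cgf[OF l] by simp
      from DERIV_chain'[OF DERIV_cmult_right[OF DERIV_ident] this]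
      have der: "((\<lambda>s. G (s * l)) has_real_derivative l * ?x) (at 1)"
        by (simp add: mult.commute)
      show ?case
      proof (intro allI impI)
        fix t :: real
        assume t: "1 \<le> t"
        show "(\<lambda>n. ?F n \<omega> (t * l)) \<longlonglongrightarrow> G l + (t - 1) * l * ?x"
        proof (rule order_tendstoI)
          fix a
          assume "a < G l + (t - 1) * l * ?x"
          then show "\<forall>\<^sub>F n in sequentially. a < ?F n \<omega> (t * l)"
            using convex_past_critical_lower[OF conv sub der t, of a] by (simp add: mult.assoc)
        next
          fix b
          assume "G l + (t - 1) * l * ?x < b"
          then have b: "0 < b - (G l + (t - 1) * l * ?x)"
            by simp
          obtain m :: nat where m: "inverse (Suc m) < (b - (G l + (t - 1) * l * ?x)) / t"
            using reals_Archimedean[of "(b - (G l + (t - 1) * l * ?x)) / t"] b t by auto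
          have "(\<lambda>n. (t - 1) * (ln (real (k n)) / real n) + t * (G l + inverse (Suc m)))
              \<longlonglongrightarrow> (t - 1) * tilted_rate M (X 1) l + t * (G l + inverse (Suc m))"
            by (intro tendsto_intros crit)
          moreover have "(t - 1) * tilted_rate M (X 1) l + t * (G l + inverse (Suc m)) < b"
            using m t by (simp add: pos_less_divide_eq tilted_rate_def algebra_simps)
          ultimately have "\<forall>\<^sub>F n in sequentially. (t - 1) * (ln (real (k n)) / real n) + t * (G l + inverse (Suc m)) < b"
            by (rule order_tendstoD)
          with ev elim(2)[rule_format, of m] show "\<forall>\<^sub>F n in sequentially. ?F n \<omega> (t * l) < b"
          proof eventually_elim
            case (elim n)
            have "?F n \<omega> (t * l) \<le> (t - 1) * (ln (real (k n)) / real n) + t * ?F n \<omega> l"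
              using elim t by (intro empirical_log_mgf_scale_le) auto
            also have "t * ?F n \<omega> l \<le> t * (G l + inverse (Suc m))"
              using elim t by (intro mult_left_mono) auto
            finally show ?case
              using elim by simp
          qed
        qed
      qed
    qed
  qed
qed

end

section \<open>The three growth regimes\<close>

theorem theorem1p1:
  fixes M :: "'a measure" and X :: "nat \<Rightarrow> 'a \<Rightarrow> real" and k :: "nat \<Rightarrow> nat"
    and D :: "real set" and l0 x0 :: real and \<Lambda> :: "real \<Rightarrow> ereal"
  assumes "prob_space M"
    and "prob_space.indep_vars M (\<lambda>_. borel) X {1..}"
    and "\<forall>n\<ge>1. distr M borel (X n) = distr M borel (X 1)"
    and "\<Lambda> = log_mgf M (X 1)"
    and "is_interval D" and "\<forall>l\<in>D. \<bar>\<Lambda> l\<bar> \<noteq> \<infinity>" and "0 \<in> interior D"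
    and "\<forall>n\<ge>1. k n \<ge> 1"
    and "l0 \<in> interior D"
    and "x0 = deriv (\<lambda>l. real_of_ereal (\<Lambda> l)) l0"
  shows
    "(liminf (\<lambda>n. ereal (ln (real (k n)) / real n)) > legendre \<Lambda> x0 \<longrightarrow>
       (\<exists>U. open U \<and> l0 \<in> U \<and> U \<subseteq> interior D \<and>
         (AE \<omega> in M.
           (\<forall>l\<in>U. (\<lambda>n. ereal (empirical_log_mgf X k n \<omega> l)) \<longlonglongrightarrow> \<Lambda> l) \<and>
           (\<exists>L :: real \<Rightarrow> ereal.
             (\<forall>\<epsilon>>0. (\<lambda>n. ereal (1 / real n) *
                 ln_ennreal (emeasure (empirical_measure X k n \<omega>) {x0 - \<epsilon>..x0 + \<epsilon>}))
               \<longlonglongrightarrow> L \<epsilon>) \<and>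
             (L \<longlongrightarrow> - legendre \<Lambda> x0) (at_right 0)))))
     \<and>
     (limsup (\<lambda>n. ereal (ln (real (k n)) / real n)) < legendre \<Lambda> x0 \<longrightarrow>
       (\<exists>\<epsilon>0>0. \<forall>\<epsilon>. 0 < \<epsilon> \<and> \<epsilon> < \<epsilon>0 \<longrightarrow>
         (AE \<omega> in M. \<forall>\<^sub>F n in sequentially.
           {j \<in> {1..k n}. block_sum X n j \<omega> \<in> {real n * (x0 - \<epsilon>)..real n * (x0 + \<epsilon>)}} = {})))
     \<and>
     ((\<lambda>n. ereal (ln (real (k n)) / real n)) \<longlonglongrightarrow> legendre \<Lambda> x0 \<longrightarrow>
       (AE \<omega> in M. \<forall>t\<ge>1.
         (\<lambda>n. ereal (empirical_log_mgf X k n \<omega> (t * l0)))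
           \<longlonglongrightarrow> \<Lambda> l0 + ereal ((t - 1) * l0 * x0)))"
proof -
  interpret prob_space M by fact
  have rv_X1: "X 1 \<in> borel_measurable M"
    using assms(2) by (auto simp: indep_vars_def)
  have integrable_D: "integrable M (\<lambda>\<omega>. exp (l * X 1 \<omega>))" if "l \<in> D" for l
  proof -
    have "(\<integral>\<^sup>+ \<omega>. ennreal (exp (l * X 1 \<omega>)) \<partial>M) < \<infinity>"
      using assms(6) that unfolding assms(4)
      by (auto simp: log_mgf_def ln_ennreal_def less_top[symmetric] split: if_splits)
    then show ?thesis
      using rv_X1 by (intro integrableI_nonneg) auto
  qed
  interpret iid_exp_moments M X "interior D"
  proof
    show "X 1 \<in> borel_measurable M" "open (interior D)"
      using rv_X1 by auto
    show "integrable M (\<lambda>\<omega>. exp (l * X 1 \<omega>))" if "l \<in> interior D" for l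
      using that interior_subset by (intro integrable_D) auto
    show "indep_vars (\<lambda>_. borel) X {1..}"
      by fact
    show "distr M borel (X n) = distr M borel (X 1)" if "n \<ge> 1" for n
      using assms(3) that by blast
  qed
  have k: "k n \<ge> 1" if "n \<ge> 1" for n
    using assms(8) that by blast
  have \<Lambda>: "\<Lambda> l = ereal (G l)" if "l \<in> interior D" for l
    unfolding assms(4) by (intro log_mgf_eq_cgf integrable_exp that)
  have x0: "x0 = tilted_mean M (X 1) l0"
  proof -
    have "((\<lambda>l. real_of_ereal (\<Lambda> l)) has_real_derivative tilted_mean M (X 1) l0) (at l0)"
      using \<Lambda> by (intro has_field_derivative_transform_within_open[OF DERIV_cgf[OF assms(9)] open_interior assms(9)]) auto
    then show ?thesis
      unfolding assms(10) by (rule DERIV_imp_deriv)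
  qed
  have leg: "legendre \<Lambda> x0 = ereal (tilted_rate M (X 1) l0)"
    unfolding assms(4) x0 by (rule legendre_tilted_mean) fact
  have "convex (interior D)"
    using assms(5) by (intro convex_interior is_interval_convex)
  then have ray: "s * l0 \<in> interior D" if "s \<in> {0..1}" for s
    using convexD[of "interior D" 0 l0 "1 - s" s] assms(7,9) that by simp
  show ?thesis
  proof (intro conjI impI)
    assume "liminf (\<lambda>n. ereal (ln (real (k n)) / real n)) > legendre \<Lambda> x0"
    from ereal_dense2[OF this] obtain c where c: "tilted_rate M (X 1) l0 < c"
        "ereal c < liminf (\<lambda>n. ereal (ln (real (k n)) / real n))"
      unfolding leg less_ereal.simps(1) by blast
    define U where "U = {l \<in> interior D. tilted_rate M (X 1) l < c}"
    have "open U"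
    proof -
      have "U = interior D \<inter> tilted_rate M (X 1) -` {..<c}"
        by (auto simp: U_def)
      then show ?thesis
        using continuous_on_tilted_rate by (auto intro!: continuous_open_preimage)
    qed
    have ray_U: "s * l0 \<in> U" if "s \<in> {0..1}" for s
      using tilted_rate_ray_mono(1)[of s l0 1] ray[of s] ray[of 1] that c by (auto simp: U_def)
    have "AE \<omega> in M. \<forall>l\<in>interior D. ereal (tilted_rate M (X 1) l) < ereal c \<longrightarrow>
        (\<lambda>n. empirical_log_mgf X k n \<omega> l) \<longlonglongrightarrow> G l"
      using c by (intro AE_empirical_log_mgf_tendsto k) auto
    then have "AE \<omega> in M.
           (\<forall>l\<in>U. (\<lambda>n. ereal (empirical_log_mgf X k n \<omega> l)) \<longlonglongrightarrow> \<Lambda> l) \<and>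
           (\<exists>L :: real \<Rightarrow> ereal.
             (\<forall>\<epsilon>>0. (\<lambda>n. ereal (1 / real n) *
                 ln_ennreal (emeasure (empirical_measure X k n \<omega>) {x0 - \<epsilon>..x0 + \<epsilon>}))
               \<longlonglongrightarrow> L \<epsilon>) \<and>
             (L \<longlongrightarrow> - legendre \<Lambda> x0) (at_right 0))"
    proof eventually_elim
      case (elim \<omega>)
      then have lim: "(\<lambda>n. empirical_log_mgf X k n \<omega> l) \<longlonglongrightarrow> G l" if "l \<in> U" for l
        using that by (auto simp: U_def)
      let ?R = "ray_interval_rate l0"
      let ?\<mu> = "\<lambda>n. empirical_measure X k n \<omega>"
      show ?case
      proof (intro conjI exI[of _ "\<lambda>\<epsilon>. ereal (- ?R \<epsilon>)"] ballI allI impI)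
        show "(\<lambda>n. ereal (empirical_log_mgf X k n \<omega> l)) \<longlonglongrightarrow> \<Lambda> l" if "l \<in> U" for l
          using lim[OF that] that by (auto simp: U_def \<Lambda>)
        show "((\<lambda>\<epsilon>. ereal (- ?R \<epsilon>)) \<longlongrightarrow> - legendre \<Lambda> x0) (at_right 0)"
          using ray_interval_rate_tendsto[OF ray] unfolding leg by (auto intro!: tendsto_intros)
        fix \<epsilon> :: real
        assume "\<epsilon> > 0"
        let ?I = "{x0 - \<epsilon>..x0 + \<epsilon>}"
        have U: "U \<subseteq> interior D"
          by (auto simp: U_def)
        have mom: "exp_moments (?\<mu> n) (\<lambda>x. x) UNIV" if "n \<ge> 1" for n
          using k[OF that] by (rule exp_moments_empirical_measure)
        have sets: "sets (?\<mu> n) = sets borel" for n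
          by (simp add: empirical_measure_def)
        have lim': "(\<lambda>n. cgf (?\<mu> n) (\<lambda>x. x) (real n * m) / real n) \<longlonglongrightarrow> G m" if "m \<in> U" for m
          using lim[OF that] by (simp add: empirical_log_mgf_eq_cgf)
        have pos: "\<forall>\<^sub>F n in sequentially. 0 < measure (?\<mu> n) ?I"
          and limI: "(\<lambda>n. 1 / real n * ln (measure (?\<mu> n) ?I)) \<longlonglongrightarrow> - ?R \<epsilon>"
          unfolding x0
          using interval_measure_rate[OF ray mom sets \<open>open U\<close> U ray_U lim' \<open>\<epsilon> > 0\<close>] by simp_all
        have "\<forall>\<^sub>F n in sequentially. ereal (1 / real n * ln (measure (?\<mu> n) ?I)) =
            ereal (1 / real n) * ln_ennreal (emeasure (?\<mu> n) ?I)"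
          using pos eventually_ge_at_top[of 1]
        proof eventually_elim
          case (elim n)
          interpret E: exp_moments "?\<mu> n" "\<lambda>x. x" UNIV
            using elim by (intro mom)
          show ?case
            using elim by (simp add: E.emeasure_eq_measure ln_ennreal_ennreal)
        qed
        then show "(\<lambda>n. ereal (1 / real n) * ln_ennreal (emeasure (?\<mu> n) ?I)) \<longlonglongrightarrow> ereal (- ?R \<epsilon>)"
          by (rule Lim_transform_eventually[rotated]) (intro tendsto_ereal limI)
      qed
    qed
    then show "\<exists>U. open U \<and> l0 \<in> U \<and> U \<subseteq> interior D \<and>
         (AE \<omega> in M.
           (\<forall>l\<in>U. (\<lambda>n. ereal (empirical_log_mgf X k n \<omega> l)) \<longlonglongrightarrow> \<Lambda> l) \<and>
           (\<exists>L :: real \<Rightarrow> ereal.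
             (\<forall>\<epsilon>>0. (\<lambda>n. ereal (1 / real n) *
                 ln_ennreal (emeasure (empirical_measure X k n \<omega>) {x0 - \<epsilon>..x0 + \<epsilon>}))
               \<longlonglongrightarrow> L \<epsilon>) \<and>
             (L \<longlongrightarrow> - legendre \<Lambda> x0) (at_right 0)))"
      using \<open>open U\<close> ray_U[of 1] by (intro exI[of _ U] conjI) (auto simp: U_def)
  next
    assume "limsup (\<lambda>n. ereal (ln (real (k n)) / real n)) < legendre \<Lambda> x0"
    from ereal_dense2[OF this] obtain c where c: "c < tilted_rate M (X 1) l0"
        "limsup (\<lambda>n. ereal (ln (real (k n)) / real n)) < ereal c"
      unfolding leg less_ereal.simps(1) by blast
    have ev: "\<forall>\<^sub>F n in sequentially. ln (real (k n)) / real n \<le> c"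
      using Limsup_lessD[OF c(2)] by eventually_elim simp
    \<comment> \<open>Makes the loss \<open>\<bar>l0\<bar> * \<epsilon>\<close> smaller than the gap between the rate and \<open>c\<close>; the summand 1 allows for
      \<open>l0 = 0\<close>.\<close>
    define \<epsilon>0 where "\<epsilon>0 = (tilted_rate M (X 1) l0 - c) / (\<bar>l0\<bar> + 1)"
    show "\<exists>\<epsilon>0>0. \<forall>\<epsilon>. 0 < \<epsilon> \<and> \<epsilon> < \<epsilon>0 \<longrightarrow>
         (AE \<omega> in M. \<forall>\<^sub>F n in sequentially.
           {j \<in> {1..k n}. block_sum X n j \<omega> \<in> {real n * (x0 - \<epsilon>)..real n * (x0 + \<epsilon>)}} = {})"
    proof (intro exI[of _ \<epsilon>0] conjI allI impI)
      show "\<epsilon>0 > 0"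
        using c by (auto simp: \<epsilon>0_def add_nonneg_pos)
      fix \<epsilon> :: real
      assume \<epsilon>: "0 < \<epsilon> \<and> \<epsilon> < \<epsilon>0"
      then have "\<epsilon> * (\<bar>l0\<bar> + 1) < tilted_rate M (X 1) l0 - c"
        by (simp add: \<epsilon>0_def pos_less_divide_eq add_nonneg_pos)
      then have "c < l0 * x0 - G l0 - \<bar>l0\<bar> * \<epsilon>"
        using \<epsilon> by (simp add: x0 tilted_rate_def algebra_simps)
      then show "AE \<omega> in M. \<forall>\<^sub>F n in sequentially.
           {j \<in> {1..k n}. block_sum X n j \<omega> \<in> {real n * (x0 - \<epsilon>)..real n * (x0 + \<epsilon>)}} = {}"
        by (intro AE_no_block_average_near[OF k assms(9) ev])
    qed
  next
    assume "(\<lambda>n. ereal (ln (real (k n)) / real n)) \<longlonglongrightarrow> legendre \<Lambda> x0"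
    then have "(\<lambda>n. ln (real (k n)) / real n) \<longlonglongrightarrow> tilted_rate M (X 1) l0"
      unfolding leg by simp
    then have "AE \<omega> in M. \<forall>t\<ge>1. (\<lambda>n. empirical_log_mgf X k n \<omega> (t * l0))
        \<longlonglongrightarrow> G l0 + (t - 1) * l0 * tilted_mean M (X 1) l0"
      by (intro AE_empirical_log_mgf_critical k ray)
    then show "AE \<omega> in M. \<forall>t\<ge>1. (\<lambda>n. ereal (empirical_log_mgf X k n \<omega> (t * l0)))
           \<longlonglongrightarrow> \<Lambda> l0 + ereal ((t - 1) * l0 * x0)"
      by eventually_elim (simp add: \<Lambda> assms(9) x0)
  qed
qed

end
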